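(* Let $n\ge 4$ and let the wheel graph $W_n$ with $n$ vertices have arbitrary nonnegative weights on its edges such that the graph remains connected after removing all zero-weight edges. Then Aldous' conjecture holds for this weighted graph: the spectral gap of the interchange process on it equals the spectral gap of the random walk on it.
   Context: The wheel graph $W_n$ has one central vertex and $n-1$ outer vertices; the outer vertices form a cycle of length $n-1$, and the central vertex is joined to every outer vertex by an edge (a spoke). Spectral gaps: number the vertices $1,\ldots,n$ and let $\alpha_{ij}=\alpha_{ji}\ge0$ be the weight of edge $(i,j)$, with $\alpha_{ij}=0$ if $(i,j)$ is not an edge. The random-walk Laplacian $\mathcal L_n^{RW}(\alpha)$ is the $n\times n$ matrix with $(i,j)$ entry $-\alpha_{ij}$ for $i\neq j$ and $(j,j)$ entry $\sum_{k\neq j}\alpha_{kj}$. The interchange Laplacian $\mathcal L_n^I(\alpha)$ is the $n!\times n!$ matrix indexed by the symmetric group $\mathcal S_n$ with entry $(\sigma,\sigma')$ equal to $-\alpha_{ij}$ if $\sigma'=(ij)\sigma$ for a transposition $(ij)$, $\sum_{1\le \ell<m\le n}\alpha_{\ell m}$ if $\sigma=\sigma'$, and $0$ otherwise. The spectral gap of the random walk (respectively interchange process) is the second smallest eigenvalue, counted with multiplicity, of $\mathcal L_n^{RW}(\alpha)$ (respectively $\mathcal L_n^I(\alpha)$). *)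

theory Defs
  imports
    "Jordan_Normal_Form.Char_Poly"
    "HOL-Library.Countable_Set"
    "HOL-Combinatorics.Permutations"
    "Graph_Theory.Graph_Theory"
begin

(* The hub is n, and 1, ..., n - 1 are the rim vertices in cyclic order. As usual for
   pair digraphs, an undirected edge is represented by its two arcs. *)
definition wheel_graph :: "nat \<Rightarrow> nat pair_pre_digraph" where
  "wheel_graph n = \<lparr> pverts = {1..n},
     parcs = (\<Union>i\<in>{1..<n}. {(i, n), (n, i), (i, i mod (n - 1) + 1), (i mod (n - 1) + 1, i)}) \<rparr>"

lemma pair_graph_wheel_graph:
  assumes "n \<ge> 4"
  shows "pair_graph (wheel_graph n)"
proof -
  have le: "i mod (n - 1) + 1 \<le> n" for i
    using assms mod_less_divisor[of "n - 1" i] by linarith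
  have ne: "i mod (n - 1) + 1 \<noteq> i" if "i < n" for i
    using assms that by (cases "i = n - 1") auto
  show ?thesis
    by unfold_locales
      (use assms le ne in
        \<open>fastforce simp: wheel_graph_def arcs_ends_def arc_to_ends_def sym_def symmetric_def\<close>)+
qed

definition edge_weights :: "nat pair_pre_digraph \<Rightarrow> (nat \<Rightarrow> nat \<Rightarrow> real) \<Rightarrow> bool" where
  "edge_weights G \<alpha> \<longleftrightarrow>
     (\<forall>i\<in>pverts G. \<forall>j\<in>pverts G.
        \<alpha> i j = \<alpha> j i \<and> 0 \<le> \<alpha> i j \<and> ((i, j) \<notin> parcs G \<longrightarrow> \<alpha> i j = 0))"

definition remove_zero_edges ::
    "(nat \<Rightarrow> nat \<Rightarrow> real) \<Rightarrow> nat pair_pre_digraph \<Rightarrow> nat pair_pre_digraph" where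
  "remove_zero_edges \<alpha> G = G\<lparr> parcs := {(i, j) \<in> parcs G. \<alpha> i j \<noteq> 0} \<rparr>"

definition rw_laplacian :: "nat \<Rightarrow> (nat \<Rightarrow> nat \<Rightarrow> real) \<Rightarrow> nat \<Rightarrow> nat \<Rightarrow> real" where
  "rw_laplacian n \<alpha> i j = (if i = j then \<Sum>k\<in>{1..n} - {j}. \<alpha> k j else - \<alpha> i j)"

definition vertex_pairs :: "nat \<Rightarrow> (nat \<times> nat) set" where
  "vertex_pairs n = {(l, m). 1 \<le> l \<and> l < m \<and> m \<le> n}"

(* The off-diagonal sum has at most one term, since \<sigma>' = (i j) \<sigma> determines the
   transposition; see interchange_laplacian_transposition. *)
definition interchange_laplacian ::
    "nat \<Rightarrow> (nat \<Rightarrow> nat \<Rightarrow> real) \<Rightarrow> (nat \<Rightarrow> nat) \<Rightarrow> (nat \<Rightarrow> nat) \<Rightarrow> real" where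
  "interchange_laplacian n \<alpha> \<sigma> \<sigma>' =
     (if \<sigma> = \<sigma>' then \<Sum>(l, m)\<in>vertex_pairs n. \<alpha> l m
      else - (\<Sum>(i, j) | (i, j) \<in> vertex_pairs n \<and> \<sigma>' = transpose i j \<circ> \<sigma>. \<alpha> i j))"

lemma interchange_laplacian_transposition:
  assumes \<sigma>: "\<sigma> permutes {1..n}" and ij: "(i, j) \<in> vertex_pairs n"
  shows "interchange_laplacian n \<alpha> \<sigma> (transpose i j \<circ> \<sigma>) = - \<alpha> i j"
proof -
  have lt: "i < j" using ij by (simp add: vertex_pairs_def)
  have surj: "surj \<sigma>" using \<sigma> by (rule permutes_surj)
  have cancel: "f = g" if "f \<circ> \<sigma> = g \<circ> \<sigma>" for f g :: "nat \<Rightarrow> nat"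
    using that surj by (metis surj_fun_eq comp_apply)
  have eq: "a = i \<and> b = j" if "transpose i j = transpose a b" "a < b" for a b :: nat
    using fun_cong[OF that(1), of i] fun_cong[OF that(1), of j] lt that(2)
    by (auto simp: transpose_def split: if_splits)
  have "{(a, b). (a, b) \<in> vertex_pairs n \<and> transpose i j \<circ> \<sigma> = transpose a b \<circ> \<sigma>} = {(i, j)}"
    using ij cancel eq by (auto simp: vertex_pairs_def)
  moreover have "\<sigma> \<noteq> transpose i j \<circ> \<sigma>"
  proof
    assume "\<sigma> = transpose i j \<circ> \<sigma>"
    then have "transpose i j = id" using cancel[of id "transpose i j"] by simp
    then show False using lt by (metis id_apply transpose_apply_first less_irrefl)
  qed
  ultimately show ?thesis by (simp add: interchange_laplacian_def)
qed

lemma interchange_laplacian_other: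
  assumes "\<sigma> \<noteq> \<sigma>'" and "\<And>i j. (i, j) \<in> vertex_pairs n \<Longrightarrow> \<sigma>' \<noteq> transpose i j \<circ> \<sigma>"
  shows "interchange_laplacian n \<alpha> \<sigma> \<sigma>' = 0"
proof -
  have "(\<Sum>(i, j) | (i, j) \<in> vertex_pairs n \<and> \<sigma>' = transpose i j \<circ> \<sigma>. \<alpha> i j) = 0"
    by (rule sum.neutral) (use assms(2) in blast)
  then show ?thesis using assms(1) by (simp add: interchange_laplacian_def)
qed

(* The matrix with rows and columns indexed by the finite set I. The enumeration
   from_nat_into I of I is arbitrary; another one conjugates the matrix by a permutation
   matrix, which does not affect its spectrum. *)
definition indexed_mat :: "'i set \<Rightarrow> ('i \<Rightarrow> 'i \<Rightarrow> 'a) \<Rightarrow> 'a mat" where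
  "indexed_mat I f =
     mat (card I) (card I) (\<lambda>(a, b). f (from_nat_into I a) (from_nat_into I b))"

(* The real eigenvalues in increasing order, repeated according to multiplicity. For the
   symmetric matrices used here these are all the eigenvalues, and algebraic and geometric
   multiplicities agree. *)
definition eigenvalue_list :: "real mat \<Rightarrow> real list" where
  "eigenvalue_list A = sorted_list_of_multiset (proots (char_poly A))"

(* List positions start at 0. *)
definition second_smallest_eigenvalue :: "real mat \<Rightarrow> real" where
  "second_smallest_eigenvalue A = eigenvalue_list A ! 1"

definition rw_spectral_gap :: "nat \<Rightarrow> (nat \<Rightarrow> nat \<Rightarrow> real) \<Rightarrow> real" where
  "rw_spectral_gap n \<alpha> = second_smallest_eigenvalue (indexed_mat {1..n} (rw_laplacian n \<alpha>))"

definition interchange_spectral_gap :: "nat \<Rightarrow> (nat \<Rightarrow> nat \<Rightarrow> real) \<Rightarrow> real" where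
  "interchange_spectral_gap n \<alpha> =
     second_smallest_eigenvalue (indexed_mat {\<sigma>. \<sigma> permutes {1..n}} (interchange_laplacian n \<alpha>))"

end

theory Submission
  imports Defs "HOL-Analysis.Function_Topology" "HOL-Analysis.Convex"
begin

text \<open>
  The argument is that of Caputo, Liggett and Richthammer, who remove the vertices one at a time.
  Removing \<open>x\<close> and adding \<open>\<alpha>\<^sub>i\<^sub>x \<alpha>\<^sub>x\<^sub>j / \<Sum>\<^sub>y \<alpha>\<^sub>x\<^sub>y\<close> to the weight of every remaining pair does not
  lower the gap of the random walk, since a function on the remaining vertices extends harmonically to
  \<open>x\<close> without changing its energy. An eigenfunction of the interchange process either projects
  onto an eigenfunction of the random walk of a single particle, or has mean zero on each set of
  permutations with a given particle at \<open>x\<close>. In the second case the octopus inequality says that the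
  reduced weights give no more energy, and induction applies on each of these sets.

  A rim vertex of a wheel has only three neighbours, and removing it leaves weights on a smaller wheel,
  so the octopus inequality is needed for at most three legs only. With legs \<open>a\<^sub>1, a\<^sub>2, a\<^sub>3\<close> of sum
  \<open>s\<close> and \<open>B = \<Sum> s a\<^sub>i \<tau>\<^sub>x\<^sub>i - \<Sum> a\<^sub>i a\<^sub>j \<tau>\<^sub>i\<^sub>j\<close> it reads \<open>B \<le> d\<close> for
  \<open>d = s\<^sup>2 - \<Sum> a\<^sub>i a\<^sub>j\<close>. In the group algebra of the symmetric group of the four vertices,
  \<open>d\<^sup>2 - B\<^sup>2 = s a\<^sub>1 a\<^sub>2 a\<^sub>3 (2 + 2 \<Sum> v - \<Sum> c)\<close> with \<open>v\<close> over the double transpositions and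
  \<open>c\<close> over the 3-cycles. This is positive semidefinite: it is a multiple of \<open>K (2 - c - c\<^sup>-\<^sup>1) K\<close>
  for one 3-cycle \<open>c\<close> and the sum \<open>K\<close> over the Klein four-group.
\<close>

section \<open>The second smallest eigenvalue and the Rayleigh quotient\<close>

definition bilin :: "'i set \<Rightarrow> ('i \<Rightarrow> 'i \<Rightarrow> real) \<Rightarrow> ('i \<Rightarrow> real) \<Rightarrow> ('i \<Rightarrow> real) \<Rightarrow> real" where
  "bilin I M f g = (\<Sum>i\<in>I. f i * (\<Sum>j\<in>I. M i j * g j))"

lemma bilin_add_scaled:
  "bilin I M (\<lambda>i. f i + t * h i) (\<lambda>i. f i + t * h i) =
   bilin I M f f + t * bilin I M f h + t * bilin I M h f + t\<^sup>2 * bilin I M h h"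
  by (simp add: bilin_def power2_eq_square sum.distrib sum_distrib_left algebra_simps)

lemma bilin_scale: "bilin I M (\<lambda>i. c * f i) (\<lambda>i. c * f i) = c\<^sup>2 * bilin I M f f"
  by (simp add: bilin_def power2_eq_square sum_distrib_left algebra_simps)

lemma bilin_sym:
  assumes "\<And>i j. i \<in> I \<Longrightarrow> j \<in> I \<Longrightarrow> M i j = M j i"
  shows "bilin I M f g = bilin I M g f"
proof -
  have "bilin I M f g = (\<Sum>i\<in>I. \<Sum>j\<in>I. f i * M i j * g j)"
    by (simp add: bilin_def sum_distrib_left algebra_simps)
  also have "\<dots> = (\<Sum>j\<in>I. \<Sum>i\<in>I. f i * M i j * g j)"
    by (rule sum.swap)
  also have "\<dots> = (\<Sum>j\<in>I. \<Sum>i\<in>I. g j * (M j i * f i))"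
    by (intro sum.cong refl) (simp add: assms)
  finally show ?thesis by (simp add: bilin_def sum_distrib_left)
qed

lemma bilin_cong:
  assumes "\<And>i. i \<in> I \<Longrightarrow> f i = f' i" "\<And>i. i \<in> I \<Longrightarrow> g i = g' i"
  shows "bilin I M f g = bilin I M f' g'"
  unfolding bilin_def by (intro sum.cong arg_cong2[where f="(*)"] refl assms)

text \<open>Both Laplacians have this property. The matrix is then self-adjoint with the constants
  in its kernel, and the functions of sum zero are an invariant complement.\<close>

definition symmetric_zero_sums :: "'i set \<Rightarrow> ('i \<Rightarrow> 'i \<Rightarrow> real) \<Rightarrow> bool" where
  "symmetric_zero_sums I M \<longleftrightarrow>
     (\<forall>i\<in>I. \<forall>j\<in>I. M i j = M j i) \<and> (\<forall>i\<in>I. (\<Sum>j\<in>I. M i j) = 0)"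

lemma sum_matrix_apply_eq_0:
  assumes "symmetric_zero_sums I M"
  shows "(\<Sum>i\<in>I. \<Sum>j\<in>I. M i j * f j) = 0"
proof -
  have "(\<Sum>i\<in>I. \<Sum>j\<in>I. M i j * f j) = (\<Sum>j\<in>I. \<Sum>i\<in>I. M i j * f j)"
    by (rule sum.swap)
  also have "\<dots> = (\<Sum>j\<in>I. (\<Sum>i\<in>I. M j i) * f j)"
    using assms unfolding symmetric_zero_sums_def sum_distrib_right
    by (intro sum.cong refl) auto
  finally show ?thesis using assms by (simp add: symmetric_zero_sums_def)
qed

definition eigenfunction :: "'i set \<Rightarrow> ('i \<Rightarrow> 'i \<Rightarrow> real) \<Rightarrow> real \<Rightarrow> ('i \<Rightarrow> real) \<Rightarrow> bool" where
  "eigenfunction I M l f \<longleftrightarrow>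
     (\<exists>i\<in>I. f i \<noteq> 0) \<and> (\<Sum>i\<in>I. f i) = 0 \<and> (\<forall>i\<in>I. (\<Sum>j\<in>I. M i j * f j) = l * f i)"

text \<open>A lower bound for the Rayleigh quotient off the constants. The gap is the
  \<open>l\<close> for which the bound holds and is attained by an
  \<open>eigenfunction\<close>.\<close>

definition poincare :: "'i set \<Rightarrow> ('i \<Rightarrow> 'i \<Rightarrow> real) \<Rightarrow> real \<Rightarrow> bool" where
  "poincare I M l \<longleftrightarrow> (\<forall>f. (\<Sum>i\<in>I. f i) = 0 \<longrightarrow> l * (\<Sum>i\<in>I. (f i)\<^sup>2) \<le> bilin I M f f)"

lemma bilin_eigenfunction:
  assumes "eigenfunction I M l f"
  shows "bilin I M f f = l * (\<Sum>i\<in>I. (f i)\<^sup>2)"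
  using assms unfolding bilin_def eigenfunction_def
  by (simp add: power2_eq_square sum_distrib_left mult_ac)

lemma sum_squares_eigenfunction_pos:
  assumes "finite I" "eigenfunction I M l f"
  shows "0 < (\<Sum>i\<in>I. (f i)\<^sup>2)"
  using assms unfolding eigenfunction_def by (auto intro: sum_pos2)

lemma poincare_le_eigenvalue:
  assumes "finite I" "poincare I M l" "eigenfunction I M m f"
  shows "l \<le> m"
proof -
  have "l * (\<Sum>i\<in>I. (f i)\<^sup>2) \<le> m * (\<Sum>i\<in>I. (f i)\<^sup>2)"
    using assms(2,3) bilin_eigenfunction[OF assms(3)]
    unfolding poincare_def eigenfunction_def by metis
  then show ?thesis
    using sum_squares_eigenfunction_pos[OF assms(1,3)] by simp
qed

text \<open>The first variation at a minimum: for small negative \<open>t\<close> the linear term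
  would outweigh the quadratic one if \<open>X\<close> were positive.\<close>

lemma nonneg_linear_quadratic_imp_eq_0:
  fixes X Y :: real
  assumes "\<And>t. 0 \<le> 2 * t * X + t\<^sup>2 * Y" "0 \<le> X"
  shows "X = 0"
proof (rule ccontr)
  assume "X \<noteq> 0"
  with assms have X: "X > 0" by simp
  \<comment> \<open>Chosen so that the modulus of \<open>t * Y\<close> is less than
    \<open>X\<close>, which leaves \<open>2 * X + t * Y\<close> positive.\<close>
  define t where "t = - X / (\<bar>Y\<bar> + X)"
  have "t * (\<bar>Y\<bar> + X) = - X" using X by (simp add: t_def)
  moreover have t: "t < 0" using X by (simp add: t_def divide_neg_pos)
  moreover have "t * Y \<le> - t * \<bar>Y\<bar>" using t by (simp add: abs_if mult_le_0_iff)
  ultimately have "2 * X + t * Y > 0"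
    using X t by (smt (verit) distrib_left mult_minus_left mult_neg_pos)
  then have "t * (2 * X + t * Y) < 0" using t by (simp add: mult_neg_pos)
  with assms(1)[of t] show False by (simp add: power2_eq_square algebra_simps)
qed

text \<open>Functions that vanish off \<open>I\<close> and have norm 1 on it lie in a product of
  compact sets, which is compact by Tychonoff's theorem, so \<open>Q\<close> attains its infimum on
  the closed constraint set.\<close>

lemma ex_constrained_minimizer:
  fixes Q :: "('i \<Rightarrow> real) \<Rightarrow> real"
  assumes I: "finite I" "card I \<ge> 2" and Q: "continuous_on UNIV Q"
  shows "\<exists>f. (\<Sum>i\<in>I. f i) = 0 \<and> (\<Sum>i\<in>I. (f i)\<^sup>2) = 1 \<and>
    (\<forall>g. (\<Sum>i\<in>I. g i) = 0 \<and> (\<Sum>i\<in>I. (g i)\<^sup>2) = 1 \<and> (\<forall>i. i \<notin> I \<longrightarrow> g i = 0) \<longrightarrow> Q f \<le> Q g)"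
proof -
  define K where "K = Pi\<^sub>E UNIV (\<lambda>i. if i \<in> I then {-1..1::real} else {0})"
  define S where "S = K \<inter> {f. (\<Sum>i\<in>I. f i) = 0} \<inter> {f. (\<Sum>i\<in>I. (f i)\<^sup>2) = 1}"
  have "compactin (product_topology (\<lambda>_. euclidean) UNIV) K"
    unfolding K_def compactin_PiE by auto
  then have "compact K" by (simp add: euclidean_product_topology)
  moreover have "closed {f::'i \<Rightarrow> real. (\<Sum>i\<in>I. f i) = 0}"
    by (intro closed_Collect_eq continuous_intros continuous_on_product_coordinates)
  moreover have "closed {f::'i \<Rightarrow> real. (\<Sum>i\<in>I. (f i)\<^sup>2) = 1}"
    by (intro closed_Collect_eq continuous_intros continuous_on_product_coordinates)
  ultimately have S: "compact S" unfolding S_def by (intro compact_Int_closed)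
  have mem: "g \<in> S \<longleftrightarrow> (\<Sum>i\<in>I. g i) = 0 \<and> (\<Sum>i\<in>I. (g i)\<^sup>2) = 1 \<and> (\<forall>i. i \<notin> I \<longrightarrow> g i = 0)" for g
  proof -
    have "\<bar>g i\<bar> \<le> 1" if "(\<Sum>i\<in>I. (g i)\<^sup>2) = 1" "i \<in> I" for i
      using member_le_sum[of i I "\<lambda>i. (g i)\<^sup>2"] that I abs_le_square_iff[of "g i" 1] by simp
    then show ?thesis
      by (auto simp: S_def K_def PiE_iff abs_le_iff minus_le_iff split: if_splits)
  qed
  obtain a b where ab: "a \<in> I" "b \<in> I" "a \<noteq> b"
    using I by (metis card_le_Suc0_iff_eq not_less_eq_eq numeral_2_eq_2)
  \<comment> \<open>A unit vector of sum zero, built from two points of \<open>I\<close>, shows that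
    the constraint set is nonempty.\<close>
  define e where "e i = (if i = a then 1 / sqrt 2 else if i = b then - 1 / sqrt 2 else 0)" for i
  have e: "e = (\<lambda>i. (if i = a then 1 / sqrt 2 else 0) - (if i = b then 1 / sqrt 2 else 0))"
    using ab by (auto simp: e_def)
  have "(e i)\<^sup>2 = (if i = a then 1 / 2 else 0) + (if i = b then 1 / 2 else 0)" for i
    using ab by (auto simp: e_def power_divide)
  then have "(\<Sum>i\<in>I. (e i)\<^sup>2) = 1" using I ab by (simp add: sum.distrib)
  moreover have "(\<Sum>i\<in>I. e i) = 0" using I ab by (simp add: e sum_subtractf)
  ultimately have "e \<in> S" using ab by (auto simp: mem e_def)
  then obtain f where "f \<in> S" "\<forall>g\<in>S. Q f \<le> Q g"
    using continuous_attains_inf[OF S, of Q] continuous_on_subset[OF Q] by blast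
  then show ?thesis by (auto simp: mem)
qed

text \<open>A minimizer of the energy among unit vectors of sum zero is an eigenfunction, by first
  variation, and the minimum is its eigenvalue.\<close>

lemma ex_spectral_gap:
  assumes I: "finite I" "card I \<ge> 2" and M: "symmetric_zero_sums I M"
  shows "\<exists>l f. eigenfunction I M l f \<and> poincare I M l"
proof -
  have "continuous_on UNIV (\<lambda>f. bilin I M f f)"
    unfolding bilin_def by (intro continuous_intros continuous_on_product_coordinates)
  from ex_constrained_minimizer[OF I this] obtain f where
    f: "(\<Sum>i\<in>I. f i) = 0" "(\<Sum>i\<in>I. (f i)\<^sup>2) = 1" and
    min: "\<And>g. (\<Sum>i\<in>I. g i) = 0 \<Longrightarrow> (\<Sum>i\<in>I. (g i)\<^sup>2) = 1 \<Longrightarrow> (\<forall>i. i \<notin> I \<longrightarrow> g i = 0) \<Longrightarrow>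
      bilin I M f f \<le> bilin I M g g" by blast
  define l where "l = bilin I M f f"
  have "l * (\<Sum>i\<in>I. (g i)\<^sup>2) \<le> bilin I M g g" if g: "(\<Sum>i\<in>I. g i) = 0" for g
  proof (cases "(\<Sum>i\<in>I. (g i)\<^sup>2) = 0")
    case True
    then have "\<forall>i\<in>I. g i = 0" using I by (simp add: sum_nonneg_eq_0_iff)
    then show ?thesis using True by (simp add: bilin_def)
  next
    case False
    define s where "s = (\<Sum>i\<in>I. (g i)\<^sup>2)"
    have s: "s > 0" using False sum_nonneg[of I "\<lambda>i. (g i)\<^sup>2"] by (simp add: s_def less_le)
    \<comment> \<open>The minimality of \<open>f\<close> is known only against unit vectors that
      vanish off \<open>I\<close>, so \<open>g\<close> is normalized and cut off.\<close>
    define h where "h i = (if i \<in> I then 1 / sqrt s * g i else 0)" for i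
    have "(\<Sum>i\<in>I. h i) = 1 / sqrt s * (\<Sum>i\<in>I. g i)"
      unfolding sum_distrib_left by (intro sum.cong) (auto simp: h_def)
    moreover have "(\<Sum>i\<in>I. (h i)\<^sup>2) = 1 / s * (\<Sum>i\<in>I. (g i)\<^sup>2)"
      unfolding sum_distrib_left using s by (intro sum.cong) (auto simp: h_def power_divide)
    ultimately have "l \<le> bilin I M h h"
      unfolding l_def using g s by (intro min) (auto simp: s_def[symmetric] h_def)
    also have "bilin I M h h = bilin I M (\<lambda>i. 1 / sqrt s * g i) (\<lambda>i. 1 / sqrt s * g i)"
      by (intro bilin_cong) (auto simp: h_def)
    also have "\<dots> = bilin I M g g / s" using s by (subst bilin_scale) (simp add: power_divide)
    finally show ?thesis using s by (simp add: s_def[symmetric] pos_le_divide_eq)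
  qed
  then have P: "poincare I M l" by (simp add: poincare_def)
  \<comment> \<open>The residual of the eigenvalue equation serves as direction of variation. It has
    sum zero, so the varied function stays admissible, and the linear coefficient becomes twice the
    squared norm of the residual.\<close>
  define h where "h i = (\<Sum>j\<in>I. M i j * f j) - l * f i" for i
  have h0: "(\<Sum>i\<in>I. h i) = 0"
    using sum_matrix_apply_eq_0[OF M, of f] f by (simp add: h_def sum_subtractf sum_distrib_left[symmetric])
  have hf: "bilin I M h f = (\<Sum>i\<in>I. (h i)\<^sup>2) + l * (\<Sum>i\<in>I. f i * h i)"
  proof -
    have "bilin I M h f = (\<Sum>i\<in>I. h i * (h i + l * f i))"
      by (simp add: bilin_def h_def)
    then show ?thesis
      by (simp add: power2_eq_square sum_distrib_left sum.distrib algebra_simps)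
  qed
  have fh: "bilin I M f h = bilin I M h f"
    by (rule bilin_sym) (use M in \<open>auto simp: symmetric_zero_sums_def\<close>)
  have "0 \<le> 2 * t * (\<Sum>i\<in>I. (h i)\<^sup>2) + t\<^sup>2 * (bilin I M h h - l * (\<Sum>i\<in>I. (h i)\<^sup>2))" for t
  proof -
    have "(\<Sum>i\<in>I. f i + t * h i) = 0"
      using f h0 by (simp add: sum.distrib sum_distrib_left[symmetric])
    then have "l * (\<Sum>i\<in>I. (f i + t * h i)\<^sup>2) \<le> bilin I M (\<lambda>i. f i + t * h i) (\<lambda>i. f i + t * h i)"
      using P unfolding poincare_def by blast
    moreover have "(\<Sum>i\<in>I. (f i + t * h i)\<^sup>2) =
        1 + 2 * t * (\<Sum>i\<in>I. f i * h i) + t\<^sup>2 * (\<Sum>i\<in>I. (h i)\<^sup>2)"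
    proof -
      have "(f i + t * h i)\<^sup>2 = (f i)\<^sup>2 + 2 * t * (f i * h i) + t\<^sup>2 * (h i)\<^sup>2" for i
        by (simp add: power2_eq_square algebra_simps)
      then show ?thesis by (simp add: sum.distrib f(2) flip: sum_distrib_left)
    qed
    ultimately show ?thesis
      unfolding bilin_add_scaled fh hf l_def[symmetric] by (simp add: algebra_simps)
  qed
  then have "(\<Sum>i\<in>I. (h i)\<^sup>2) = 0"
    by (rule nonneg_linear_quadratic_imp_eq_0) (simp add: sum_nonneg)
  then have "\<forall>i\<in>I. h i = 0" using I by (simp add: sum_nonneg_eq_0_iff)
  moreover have "\<exists>i\<in>I. f i \<noteq> 0" 
  proof (rule ccontr)
    assume "\<not> ?thesis"
    then have "(\<Sum>i\<in>I. (f i)\<^sup>2) = 0" by simp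
    then show False using f(2) by simp
  qed
  ultimately have "eigenfunction I M l f" using f by (auto simp: eigenfunction_def h_def)
  with P show ?thesis by blast
qed

text \<open>Deflation by the constant eigenvector: conjugate by the matrix that replaces the first unit vector
  by the all-ones vector.\<close>

lemma char_poly_zero_row_sums:
  fixes A :: "'a :: {field} mat"
  assumes A: "A \<in> carrier_mat (Suc m) (Suc m)"
    and sums: "\<And>i. i < Suc m \<Longrightarrow> (\<Sum>j = 0..<Suc m. A $$ (i, j)) = 0"
  shows "char_poly A =
    [:0, 1:] * char_poly (mat m m (\<lambda>(i, j). A $$ (Suc i, Suc j) - A $$ (0, Suc j)))"
proof -
  define B where "B = mat m m (\<lambda>(i, j). A $$ (Suc i, Suc j) - A $$ (0, Suc j))"
  define A2 where "A2 = mat 1 m (\<lambda>(i, j). A $$ (0, Suc j))"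
  \<comment> \<open>This is \<open>Q * A * P\<close>: multiplication by \<open>P\<close> puts the
    row sums of \<open>A\<close> into column 0, and multiplication by \<open>Q\<close> subtracts row
    0 from the other rows.\<close>
  define C where "C = four_block_mat (0\<^sub>m 1 1) A2 (0\<^sub>m m 1) B"
  define P :: "'a mat" where
    "P = mat (Suc m) (Suc m) (\<lambda>(i, j). if j = 0 then 1 else if j = i then 1 else 0)"
  define Q :: "'a mat" where
    "Q = mat (Suc m) (Suc m) (\<lambda>(i, j). if i = j then 1 else if j = 0 then - 1 else 0)"
  have C: "C \<in> carrier_mat (Suc m) (Suc m)" by (auto simp: C_def A2_def B_def)
  have PQ: "P \<in> carrier_mat (Suc m) (Suc m)" "Q \<in> carrier_mat (Suc m) (Suc m)"
    by (auto simp: P_def Q_def)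
  have C_entry: "C $$ (i, j) =
      (if j = 0 then 0 else if i = 0 then A $$ (0, j) else A $$ (i, j) - A $$ (0, j))"
    if "i < Suc m" "j < Suc m" for i j
    using that by (auto simp: C_def A2_def B_def)
  have P_mult: "(P * X) $$ (i, j) = X $$ (0, j) + (if i = 0 then 0 else X $$ (i, j))"
    if "i < Suc m" "j < Suc m" "X \<in> carrier_mat (Suc m) (Suc m)" for X i j
  proof -
    have "(P * X) $$ (i, j) = (\<Sum>k = 0..<Suc m. P $$ (i, k) * X $$ (k, j))"
      using that PQ by (simp add: scalar_prod_def)
    also have "\<dots> = X $$ (0, j) + (\<Sum>k = Suc 0..<Suc m. P $$ (i, k) * X $$ (k, j))"
      using that by (subst sum.atLeast_Suc_lessThan) (auto simp: P_def)
    also have "(\<Sum>k = Suc 0..<Suc m. P $$ (i, k) * X $$ (k, j)) =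
        (\<Sum>k = Suc 0..<Suc m. if k = i then X $$ (k, j) else 0)"
      using that by (intro sum.cong) (auto simp: P_def)
    finally show ?thesis using that by auto
  qed
  have "P * Q = 1\<^sub>m (Suc m)"
    by (rule eq_matI) (use PQ in \<open>auto simp: P_mult simp del: index_mult_mat(1)\<close>, auto simp: Q_def)
  moreover from this have "Q * P = 1\<^sub>m (Suc m)"
    using PQ mat_mult_left_right_inverse by blast
  moreover have "A * P = P * C"
  proof (rule eq_matI)
    fix i j assume "i < dim_row (P * C)" "j < dim_col (P * C)"
    then have ij: "i < Suc m" "j < Suc m" using PQ C by auto
    have "(A * P) $$ (i, j) = (\<Sum>k = 0..<Suc m. A $$ (i, k) * P $$ (k, j))"
      using ij A PQ by (simp add: scalar_prod_def)
    also have "\<dots> = (if j = 0 then 0 else A $$ (i, j))"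
    proof (cases "j = 0")
      case True
      then show ?thesis using ij sums[OF ij(1)] by (simp add: P_def)
    next
      case False
      have "(\<Sum>k = 0..<Suc m. A $$ (i, k) * P $$ (k, j)) =
          (\<Sum>k = 0..<Suc m. if k = j then A $$ (i, k) else 0)"
        using ij False by (intro sum.cong) (auto simp: P_def)
      then show ?thesis using ij False by simp
    qed
    also have "\<dots> = (P * C) $$ (i, j)"
      using ij C by (auto simp: P_mult C_entry simp del: index_mult_mat(1))
    finally show "(A * P) $$ (i, j) = (P * C) $$ (i, j)" .
  qed (use A PQ C in auto)
  then have "P * C * Q = A * P * Q" by simp
  moreover have "A * P * Q = A * (P * Q)" using A PQ by simp
  ultimately have "similar_mat_wit A C P Q"
    using A C PQ by (auto simp: similar_mat_wit_def Let_def)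
  then have "char_poly A = char_poly C"
    by (intro char_poly_similar) (auto simp: similar_mat_def)
  also have "\<dots> = char_poly (0\<^sub>m 1 1 :: 'a mat) * char_poly B"
    unfolding C_def by (rule char_poly_four_block_zeros_col[of _ _ m]) (auto simp: A2_def B_def)
  also have "char_poly (0\<^sub>m 1 1 :: 'a mat) = [:0, 1:]"
    by (subst char_poly_upper_triangular[of _ 1]) (auto simp: diag_mat_def)
  finally show ?thesis by (simp only: B_def)
qed

text \<open>The 0 contributed by the constants comes first because \<open>l\<close> is nonnegative;
  if \<open>l = 0\<close>, the two equal entries still occupy positions 0 and 1.\<close>

lemma sorted_list_of_multiset_nth_1:
  fixes X :: "real multiset"
  assumes "l \<in># X" "\<And>x. x \<in># X \<Longrightarrow> l \<le> x" "0 \<le> l"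
  shows "sorted_list_of_multiset (add_mset 0 X) ! 1 = l"
proof -
  obtain Y where Y: "X = add_mset l Y" using assms(1) by (metis mset_add)
  have ins: "sorted_list_of_multiset (add_mset a Z) = a # sorted_list_of_multiset Z"
    if "\<And>z. z \<in># Z \<Longrightarrow> a \<le> z" for a and Z :: "real multiset"
    using that by (simp add: insort_is_Cons)
  have "sorted_list_of_multiset (add_mset 0 X) = 0 # l # sorted_list_of_multiset Y"
    using assms ins[of "add_mset l Y" 0] ins[of Y l] order_trans[of 0 l] unfolding Y by auto
  then show ?thesis by simp
qed

text \<open>The deflated matrix \<open>B\<close> acts on functions modulo constants. Each class has
  one representative vanishing at \<open>e 0\<close> and one of sum zero, so the eigenvalues of
  \<open>B\<close> are those that have an \<open>eigenfunction\<close>, and \<open>poincare\<close>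
  makes \<open>l\<close> the least of them.\<close>

lemma second_smallest_eigenvalue_eq:
  assumes I: "finite I" "card I \<ge> 2" and M: "symmetric_zero_sums I M"
    and ef: "eigenfunction I M l f0" and P: "poincare I M l" and l: "0 \<le> l"
  shows "second_smallest_eigenvalue (indexed_mat I M) = l"
proof -
  define e where "e = from_nat_into I"
  define A where "A = indexed_mat I M"
  obtain m where m: "card I = Suc m" using I by (cases "card I") auto
  have bij: "bij_betw e {0..<Suc m} I"
    using bij_betw_from_nat_into_finite[OF I(1)] by (simp add: e_def m atLeast0LessThan)
  have e_in: "e i \<in> I" if "i < Suc m" for i using bij that by (auto simp: bij_betw_def)
  have sum_e: "(\<Sum>j = 0..<Suc m. h (e j)) = (\<Sum>j\<in>I. h j)" for h :: "'a \<Rightarrow> real"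
    by (rule sum.reindex_bij_betw[OF bij])
  have A: "A \<in> carrier_mat (Suc m) (Suc m)" by (simp add: A_def indexed_mat_def m)
  have A_entry: "A $$ (i, j) = M (e i) (e j)" if "i < Suc m" "j < Suc m" for i j
    using that by (simp add: A_def indexed_mat_def m e_def)
  have row_sum: "(\<Sum>j\<in>I. M a j) = 0" if "a \<in> I" for a
    using M that unfolding symmetric_zero_sums_def by blast
  define B where "B = mat m m (\<lambda>(i, j). A $$ (Suc i, Suc j) - A $$ (0, Suc j))"
  have B: "B \<in> carrier_mat m m" by (simp add: B_def)
  have "char_poly A = [:0, 1:] * char_poly B"
    unfolding B_def
  proof (rule char_poly_zero_row_sums[OF A])
    fix i assume i: "i < Suc m"
    then have "(\<Sum>j = 0..<Suc m. A $$ (i, j)) = (\<Sum>j = 0..<Suc m. M (e i) (e j))"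
      by (intro sum.cong) (auto simp: A_entry)
    then show "(\<Sum>j = 0..<Suc m. A $$ (i, j)) = 0"
      using sum_e[of "M (e i)"] row_sum e_in[OF i] by metis
  qed
  moreover have B0: "char_poly B \<noteq> 0" using degree_monic_char_poly[OF B] by auto
  ultimately have roots: "proots (char_poly A) = add_mset 0 (proots (char_poly B))"
    by (simp add: proots_mult del: mult_pCons_left)
  have B_apply: "(B *\<^sub>v v) $ i =
      (\<Sum>j\<in>I. M (e (Suc i)) j * g j) - (\<Sum>j\<in>I. M (e 0) j * g j)"
    if v: "v \<in> carrier_vec m" "\<And>i. i < m \<Longrightarrow> g (e (Suc i)) = v $ i" "g (e 0) = 0" and i: "i < m"
    for v g i
  proof -
    have row: "(\<Sum>j = 0..<m. M a (e (Suc j)) * v $ j) = (\<Sum>j\<in>I. M a j * g j)" for a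
    proof -
      have "(\<Sum>j\<in>I. M a j * g j) = (\<Sum>j = 0..<Suc m. M a (e j) * g (e j))"
        using sum_e[of "\<lambda>j. M a j * g j"] by simp
      also have "\<dots> = (\<Sum>j = 0..<m. M a (e (Suc j)) * g (e (Suc j)))"
        by (subst sum.atLeast0_lessThan_Suc_shift) (simp add: v)
      finally show ?thesis by (simp add: v)
    qed
    have "(B *\<^sub>v v) $ i = (\<Sum>j = 0..<m. (M (e (Suc i)) (e (Suc j)) - M (e 0) (e (Suc j))) * v $ j)"
      using v i by (simp add: B_def scalar_prod_def A_entry)
    then show ?thesis by (simp add: left_diff_distrib sum_subtractf row)
  qed
  have "eigenvalue B l"
  proof -
    \<comment> \<open>The representative of \<open>f0\<close> modulo constants that vanishes at
      \<open>e 0\<close>, as the coordinates of \<open>B\<close> require.\<close>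
    define g where "g a = f0 a - f0 (e 0)" for a
    define v where "v = vec m (\<lambda>i. g (e (Suc i)))"
    have Mg: "(\<Sum>j\<in>I. M a j * g j) = l * f0 a" if "a \<in> I" for a
      using ef row_sum that unfolding eigenfunction_def
      by (simp add: g_def right_diff_distrib sum_subtractf flip: sum_distrib_right)
    have "v \<noteq> 0\<^sub>v m"
    proof
      assume v0: "v = 0\<^sub>v m"
      have c: "f0 (e i) = f0 (e 0)" if "i < Suc m" for i
      proof (cases i)
        case (Suc k)
        then have k: "k < m" using that by simp
        have "g (e (Suc k)) = v $ k" using k by (simp add: v_def)
        also have "\<dots> = 0" unfolding v0 using k by simp
        finally show ?thesis unfolding Suc g_def by simp
      qed simp
      then have c: "f0 a = f0 (e 0)" if "a \<in> I" for a
        using bij that unfolding bij_betw_def by (metis atLeastLessThan_iff imageE)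
      then have "(\<Sum>a\<in>I. f0 a) = (\<Sum>a\<in>I. f0 (e 0))" by (intro sum.cong) auto
      then have "f0 (e 0) = 0" using ef m by (simp add: eigenfunction_def)
      then show False using ef c by (auto simp: eigenfunction_def)
    qed
    moreover have "B *\<^sub>v v = l \<cdot>\<^sub>v v"
    proof (rule eq_vecI)
      fix i assume "i < dim_vec (l \<cdot>\<^sub>v v)"
      then have i: "i < m" by (simp add: v_def)
      have "(B *\<^sub>v v) $ i =
        (\<Sum>j\<in>I. M (e (Suc i)) j * g j) - (\<Sum>j\<in>I. M (e 0) j * g j)"
        by (rule B_apply) (auto simp: v_def g_def i)
      also have "\<dots> = l * f0 (e (Suc i)) - l * f0 (e 0)" using i by (simp add: Mg e_in)
      also have "\<dots> = (l \<cdot>\<^sub>v v) $ i" using i by (simp add: v_def g_def right_diff_distrib)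
      finally show "(B *\<^sub>v v) $ i = (l \<cdot>\<^sub>v v) $ i" .
    qed (simp add: B_def v_def)
    ultimately show ?thesis
      unfolding eigenvalue_def eigenvector_def using B by (intro exI[of _ v]) (auto simp: v_def)
  qed
  then have "l \<in># proots (char_poly B)"
    using eigenvalue_root_char_poly[OF B] B0 by simp
  moreover have "l \<le> x" if "x \<in># proots (char_poly B)" for x
  proof -
    have "eigenvalue B x" using that eigenvalue_root_char_poly[OF B] B0 by simp
    then obtain v where v: "v \<in> carrier_vec m" "v \<noteq> 0\<^sub>v m" "B *\<^sub>v v = x \<cdot>\<^sub>v v"
      using B by (auto simp: eigenvalue_def eigenvector_def)
    define g where "g a = (let i = inv_into {0..<Suc m} e a in if i = 0 then 0 else v $ (i - 1))" for a
    have inv: "inv_into {0..<Suc m} e (e i) = i" if "i < Suc m" for i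
      using bij that by (auto simp: bij_betw_def intro!: inv_into_f_f)
    have g0: "g (e 0) = 0" and gS: "\<And>i. i < m \<Longrightarrow> g (e (Suc i)) = v $ i"
      by (auto simp: g_def inv)
    \<comment> \<open>An eigenvector of \<open>B\<close> satisfies the eigenvalue equation of
      \<open>M\<close> only modulo constants; \<open>c\<close> is the defect.\<close>
    define c where "c = (\<Sum>j\<in>I. M (e 0) j * g j)"
    have Mg: "(\<Sum>j\<in>I. M (e i) j * g j) = x * g (e i) + c" if "i < Suc m" for i
    proof (cases i)
      case 0
      then show ?thesis by (simp add: c_def g0)
    next
      case (Suc k)
      then have "(B *\<^sub>v v) $ k = x * v $ k" using v that by simp
      then show ?thesis using B_apply[OF v(1) gS g0, of k] Suc that by (simp add: gS c_def)
    qed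
    then have Mg: "(\<Sum>j\<in>I. M a j * g j) = x * g a + c" if "a \<in> I" for a
      using bij that by (auto simp: bij_betw_def)
    define t where "t = (\<Sum>a\<in>I. g a) / Suc m"
    define f where "f a = g a - t" for a
    have sf: "(\<Sum>a\<in>I. f a) = 0" by (simp add: f_def sum_subtractf m t_def)
    \<comment> \<open>The left side of the equation sums to 0 over \<open>I\<close>. This forces
      \<open>c = - x * t\<close>, which is exactly what centring \<open>g\<close> by its mean
      \<open>t\<close> absorbs.\<close>
    have "(\<Sum>a\<in>I. x * g a + c) = 0"
      using sum_matrix_apply_eq_0[OF M, of g] Mg by simp
    then have "x * (\<Sum>a\<in>I. g a) + Suc m * c = 0"
      by (simp add: sum.distrib m flip: sum_distrib_left)
    moreover have "(\<Sum>a\<in>I. g a) = Suc m * t" by (simp add: t_def)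
    ultimately have "Suc m * (x * t + c) = 0" by (simp add: algebra_simps)
    then have c: "c = - x * t" by (simp add: add_eq_0_iff)
    have "(\<Sum>j\<in>I. M a j * f j) = x * f a" if "a \<in> I" for a
      using Mg[OF that] row_sum that
      by (simp add: f_def c right_diff_distrib sum_subtractf flip: sum_distrib_right)
    moreover have "\<exists>a\<in>I. f a \<noteq> 0"
    proof (rule ccontr)
      assume "\<not> ?thesis"
      then have "g (e i) = t" if "i < Suc m" for i using e_in[OF that] by (auto simp: f_def)
      then have "g (e (Suc i)) = 0" if "i < m" for i using g0 that by (metis Suc_mono zero_less_Suc)
      then have "v = 0\<^sub>v m" using v gS by (intro eq_vecI) auto
      with v show False by simp
    qed
    ultimately have "eigenfunction I M x f" using sf by (auto simp: eigenfunction_def)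
    then show ?thesis using poincare_le_eigenvalue[OF I(1) P] by blast
  qed
  ultimately show ?thesis
    unfolding second_smallest_eigenvalue_def eigenvalue_list_def A_def[symmetric] roots
    using l by (rule sorted_list_of_multiset_nth_1)
qed

section \<open>The octopus inequality with at most three legs\<close>

text \<open>\<open>corr V F g h\<close> is the inner product of the left translates of \<open>F\<close> by \<open>g\<close> and \<open>h\<close>; it depends only
  on the quotient of \<open>g\<close> and \<open>h\<close>.\<close>

definition corr :: "'a set \<Rightarrow> (('a \<Rightarrow> 'a) \<Rightarrow> real) \<Rightarrow> ('a \<Rightarrow> 'a) \<Rightarrow> ('a \<Rightarrow> 'a) \<Rightarrow> real" where
  "corr V F g h = (\<Sum>\<sigma> | \<sigma> permutes V. F (g \<circ> \<sigma>) * F (h \<circ> \<sigma>))"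

lemma corr_commute: "corr V F g h = corr V F h g"
  by (simp add: corr_def mult.commute)

lemma corr_translate:
  assumes "q permutes V"
  shows "corr V F (g \<circ> q) (h \<circ> q) = corr V F g h"
  unfolding corr_def
  by (subst (2) setum_permutations_compose_left[OF assms]) (simp add: comp_assoc)

lemma corr_transpose_transpose:
  assumes "p \<in> V" "q \<in> V"
  shows "corr V F id (h \<circ> transpose p q) = corr V F (transpose p q) h"
  using corr_translate[OF permutes_swap_id[OF assms], of F "transpose p q" h] by simp

lemma transpose_triangle:
  assumes "p \<noteq> q" "q \<noteq> r" "p \<noteq> r"
  shows "transpose p q \<circ> transpose q r = transpose q r \<circ> transpose p r"
    "transpose q r \<circ> transpose p r = transpose p r \<circ> transpose p q"
  using assms by (auto simp: fun_eq_iff transpose_def)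

text \<open>The products of two distinct transpositions of a triangle give only one 3-cycle and its
  inverse, and \<open>corr\<close> does not distinguish these.\<close>

lemma corr_triangle:
  assumes "p \<in> V" "q \<in> V" "r \<in> V" "p \<noteq> q" "q \<noteq> r" "p \<noteq> r"
  shows "corr V F (transpose p r) (transpose q r) = corr V F (transpose p q) (transpose p r)"
    "corr V F (transpose q r) (transpose p q) = corr V F (transpose p q) (transpose p r)"
  using transpose_triangle[of p q r] assms
  by (simp_all flip: corr_transpose_transpose)

lemma corr_same:
  assumes "p \<in> V" "q \<in> V"
  shows "corr V F (transpose p q) (transpose p q) = corr V F id id"
  using corr_transpose_transpose[OF assms, of F "transpose p q"] by simp

lemma sum_square_diff_transpose:
  assumes "p \<in> V" "q \<in> V"
  shows "(\<Sum>\<sigma> | \<sigma> permutes V. (F \<sigma> - F (transpose p q \<circ> \<sigma>))\<^sup>2) =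
    2 * corr V F id id - 2 * corr V F id (transpose p q)"
proof -
  have "(\<Sum>\<sigma> | \<sigma> permutes V. (F \<sigma> - F (transpose p q \<circ> \<sigma>))\<^sup>2) =
      corr V F id id + corr V F (transpose p q) (transpose p q) - 2 * corr V F id (transpose p q)"
    unfolding corr_def sum_distrib_left sum.distrib[symmetric] sum_subtractf[symmetric]
    by (intro sum.cong refl) (simp add: power2_eq_square algebra_simps)
  then show ?thesis by (simp add: corr_same[OF assms])
qed

text \<open>With \<open>g\<close> the image of \<open>f\<close> under a self-adjoint
  \<open>B\<close>, this passes from \<open>B\<^sup>2 \<le> d\<^sup>2\<close> to
  \<open>B \<le> d\<close>, by Cauchy-Schwarz.\<close>

lemma sum_mult_le_of_square_le:
  fixes f g :: "'i \<Rightarrow> real"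
  assumes "(\<Sum>i\<in>I. (g i)\<^sup>2) \<le> d\<^sup>2 * (\<Sum>i\<in>I. (f i)\<^sup>2)" "0 \<le> d"
  shows "(\<Sum>i\<in>I. f i * g i) \<le> d * (\<Sum>i\<in>I. (f i)\<^sup>2)"
proof (rule power2_le_imp_le)
  have "(\<Sum>i\<in>I. f i * g i)\<^sup>2 \<le> (\<Sum>i\<in>I. (f i)\<^sup>2) * (\<Sum>i\<in>I. (g i)\<^sup>2)"
    by (rule Cauchy_Schwarz_ineq_sum)
  also have "\<dots> \<le> (\<Sum>i\<in>I. (f i)\<^sup>2) * (d\<^sup>2 * (\<Sum>i\<in>I. (f i)\<^sup>2))"
    by (intro mult_left_mono assms sum_nonneg) simp
  finally show "(\<Sum>i\<in>I. f i * g i)\<^sup>2 \<le> (d * (\<Sum>i\<in>I. (f i)\<^sup>2))\<^sup>2"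
    by (simp add: power2_eq_square mult_ac)
qed (use assms in \<open>simp add: sum_nonneg\<close>)

text \<open>With two legs the bound on the square is an equality: the 3-cycles enter with total
  coefficient \<open>2 * s * a * b * (s - a - b)\<close>, which is 0.\<close>

lemma octopus_2:
  fixes F :: "('a \<Rightarrow> 'a) \<Rightarrow> real" and a b :: real
  assumes V: "x \<in> V" "p \<in> V" "q \<in> V" and ne: "x \<noteq> p" "x \<noteq> q" "p \<noteq> q"
    and pos: "0 \<le> a" "0 \<le> b"
  shows "(\<Sum>\<sigma> | \<sigma> permutes V. a * b * (F \<sigma> - F (transpose p q \<circ> \<sigma>))\<^sup>2) \<le>
    (a + b) * (\<Sum>\<sigma> | \<sigma> permutes V.
      a * (F \<sigma> - F (transpose x p \<circ> \<sigma>))\<^sup>2 + b * (F \<sigma> - F (transpose x q \<circ> \<sigma>))\<^sup>2)"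
proof -
  let ?S = "{\<sigma>. \<sigma> permutes V}"
  let ?X = "\<lambda>p \<sigma>. F (transpose x p \<circ> \<sigma>)" and ?Y = "\<lambda>\<sigma>. F (transpose p q \<circ> \<sigma>)"
  define s where "s = a + b"
  define d where "d = s\<^sup>2 - a * b"
  define B where "B \<sigma> = s * a * ?X p \<sigma> + s * b * ?X q \<sigma> - a * b * ?Y \<sigma>" for \<sigma>
  have "d = a\<^sup>2 + a * b + b\<^sup>2" unfolding d_def s_def by (simp add: power2_sum algebra_simps)
  then have d: "0 \<le> d" using pos by simp
  define N c where "N = corr V F id id" and "c = corr V F (transpose x p) (transpose x q)"
  have c: "corr V F (transpose x p) (transpose p q) = c" "corr V F (transpose x q) (transpose p q) = c"
    unfolding c_def using corr_triangle[of x V p q F] V ne by (auto simp: corr_commute)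
  have "(\<Sum>\<sigma>\<in>?S. (B \<sigma>)\<^sup>2) =
      (s * a)\<^sup>2 * corr V F (transpose x p) (transpose x p) + (s * b)\<^sup>2 * corr V F (transpose x q) (transpose x q)
      + (a * b)\<^sup>2 * corr V F (transpose p q) (transpose p q)
      + 2 * (s * a) * (s * b) * corr V F (transpose x p) (transpose x q)
      - 2 * (s * a) * (a * b) * corr V F (transpose x p) (transpose p q)
      - 2 * (s * b) * (a * b) * corr V F (transpose x q) (transpose p q)"
    unfolding corr_def sum_distrib_left sum.distrib[symmetric] sum_subtractf[symmetric]
    by (intro sum.cong refl) (simp add: B_def power2_eq_square algebra_simps)
  also have "\<dots> = d\<^sup>2 * N"
    unfolding c c_def[symmetric] using V
    by (simp add: corr_same N_def[symmetric] d_def s_def power2_eq_square algebra_simps)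
  also have "N = (\<Sum>\<sigma>\<in>?S. (F \<sigma>)\<^sup>2)" by (simp add: N_def corr_def power2_eq_square)
  finally have "(\<Sum>\<sigma>\<in>?S. F \<sigma> * B \<sigma>) \<le> d * (\<Sum>\<sigma>\<in>?S. (F \<sigma>)\<^sup>2)"
    using d by (intro sum_mult_le_of_square_le) auto
  moreover have "(\<Sum>\<sigma>\<in>?S. F \<sigma> * B \<sigma>) =
      s * a * corr V F id (transpose x p) + s * b * corr V F id (transpose x q) - a * b * corr V F id (transpose p q)"
    unfolding corr_def sum_distrib_left sum.distrib[symmetric] sum_subtractf[symmetric]
    by (intro sum.cong refl) (simp add: B_def algebra_simps)
  moreover have "(\<Sum>\<sigma>\<in>?S. (F \<sigma>)\<^sup>2) = N" by (simp add: N_def corr_def power2_eq_square)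
  ultimately show ?thesis
    using V by (simp add: sum.distrib sum_square_diff_transpose flip: sum_distrib_left)
      (simp add: N_def[symmetric] d_def s_def power2_eq_square algebra_simps)
qed

text \<open>The left-hand side is the sum over the four pairs of mutually inverse 3-cycles.\<close>

lemma klein_corr_bound:
  assumes V: "x \<in> V" "p \<in> V" "q \<in> V" "r \<in> V"
    and ne: "x \<noteq> p" "x \<noteq> q" "x \<noteq> r" "p \<noteq> q" "p \<noteq> r" "q \<noteq> r"
  shows "corr V F (transpose q r) (transpose p q) + corr V F (transpose x p) (transpose p r)
      + corr V F (transpose x q) (transpose p q) + corr V F (transpose x r) (transpose q r)
    \<le> corr V F id id + corr V F (transpose x p) (transpose q r)
      + corr V F (transpose x q) (transpose p r) + corr V F (transpose x r) (transpose p q)"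
proof -
  let ?S = "{\<sigma>. \<sigma> permutes V}"
  \<comment> \<open>With the identity, \<open>d1\<close>, \<open>d2\<close>, \<open>d3\<close> form
    the Klein four-group. The 3-cycle \<open>c\<close> permutes them cyclically by conjugation, and
    the coset of \<open>c\<close> contains one 3-cycle from each mutually inverse pair.\<close>
  define d1 d2 d3 c where "d1 = transpose x p \<circ> transpose q r" and "d2 = transpose x q \<circ> transpose p r"
    and "d3 = transpose x r \<circ> transpose p q" and "c = transpose p q \<circ> transpose q r"
  note ds = d1_def d2_def d3_def
  have perm: "d1 permutes V" "d2 permutes V" "d3 permutes V" "c permutes V"
    unfolding ds c_def using V by (auto intro!: permutes_compose permutes_swap_id)
  have ext4: "f = g" if "f x = g x" "f p = g p" "f q = g q" "f r = g r"
    "\<And>y. y \<noteq> x \<Longrightarrow> y \<noteq> p \<Longrightarrow> y \<noteq> q \<Longrightarrow> y \<noteq> r \<Longrightarrow> f y = g y" for f g :: "'a \<Rightarrow> 'a"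
    using that by (metis ext)
  have klein: "d1 \<circ> d1 = id" "d2 \<circ> d2 = id" "d3 \<circ> d3 = id" "d1 \<circ> d2 = d3" "d2 \<circ> d1 = d3"
    "d1 \<circ> d3 = d2" "d3 \<circ> d1 = d2" "d2 \<circ> d3 = d1" "d3 \<circ> d2 = d1"
    unfolding ds by (rule ext4; use ne ne[symmetric] in \<open>simp add: transpose_def\<close>)+
  have conj: "c \<circ> d1 = d2 \<circ> c" "c \<circ> d2 = d3 \<circ> c" "c \<circ> d3 = d1 \<circ> c"
    unfolding ds c_def by (rule ext4; use ne ne[symmetric] in \<open>simp add: transpose_def\<close>)+
  have cyc: "d1 \<circ> c = transpose x p \<circ> transpose p r" "d2 \<circ> c = transpose x q \<circ> transpose p q"
    "d3 \<circ> c = transpose x r \<circ> transpose q r"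
    unfolding ds c_def by (rule ext4; use ne ne[symmetric] in \<open>simp add: transpose_def\<close>)+
  \<comment> \<open>The Klein sum of \<open>F\<close>. Being invariant, it has a squared distance
    from its translate by \<open>c\<close> that involves only the Klein group and the coset of
    \<open>c\<close>.\<close>
  define G where "G \<sigma> = F \<sigma> + F (d1 \<circ> \<sigma>) + F (d2 \<circ> \<sigma>) + F (d3 \<circ> \<sigma>)" for \<sigma>
  have k: "d \<circ> (d' \<circ> \<sigma>) = e \<circ> \<sigma>" if "d \<circ> d' = e" for d d' e \<sigma> :: "'a \<Rightarrow> 'a"
    using that by (simp add: comp_assoc[symmetric])
  have G_inv: "G (d1 \<circ> \<sigma>) = G \<sigma>" "G (d2 \<circ> \<sigma>) = G \<sigma>" "G (d3 \<circ> \<sigma>) = G \<sigma>" for \<sigma>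
    by (simp_all add: G_def klein[THEN k])
  \<comment> \<open>Against an invariant \<open>H\<close> the four translates of \<open>F\<close>
    contribute equally. This undoes one of the two Klein sums, and the factor 4 cancels
    later.\<close>
  have sum_G: "(\<Sum>\<sigma>\<in>?S. G \<sigma> * H \<sigma>) = 4 * (\<Sum>\<sigma>\<in>?S. F \<sigma> * H \<sigma>)"
    if H: "\<And>\<sigma>. H (d1 \<circ> \<sigma>) = H \<sigma>" "\<And>\<sigma>. H (d2 \<circ> \<sigma>) = H \<sigma>" "\<And>\<sigma>. H (d3 \<circ> \<sigma>) = H \<sigma>" for H
  proof -
    have "(\<Sum>\<sigma>\<in>?S. F (d \<circ> \<sigma>) * H \<sigma>) = (\<Sum>\<sigma>\<in>?S. F \<sigma> * H \<sigma>)"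
      if "d permutes V" "\<And>\<sigma>. H (d \<circ> \<sigma>) = H \<sigma>" for d
      by (subst (2) setum_permutations_compose_left[OF that(1)]) (simp add: that(2))
    from this[OF perm(1) H(1)] this[OF perm(2) H(2)] this[OF perm(3) H(3)] show ?thesis
      by (simp add: G_def distrib_right sum.distrib)
  qed
  have "0 \<le> (\<Sum>\<sigma>\<in>?S. (G \<sigma> - G (c \<circ> \<sigma>))\<^sup>2)" by (rule sum_nonneg) simp
  also have "\<dots> = (\<Sum>\<sigma>\<in>?S. G \<sigma> * G \<sigma>) + (\<Sum>\<sigma>\<in>?S. G (c \<circ> \<sigma>) * G (c \<circ> \<sigma>)) - 2 * (\<Sum>\<sigma>\<in>?S. G \<sigma> * G (c \<circ> \<sigma>))"
    unfolding sum_distrib_left sum.distrib[symmetric] sum_subtractf[symmetric]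
    by (intro sum.cong refl) (simp add: power2_eq_square algebra_simps)
  also have "(\<Sum>\<sigma>\<in>?S. G (c \<circ> \<sigma>) * G (c \<circ> \<sigma>)) = (\<Sum>\<sigma>\<in>?S. G \<sigma> * G \<sigma>)"
    by (rule setum_permutations_compose_left[OF perm(4), symmetric])
  finally have "(\<Sum>\<sigma>\<in>?S. G \<sigma> * G (c \<circ> \<sigma>)) \<le> (\<Sum>\<sigma>\<in>?S. G \<sigma> * G \<sigma>)" by linarith
  moreover have "(\<Sum>\<sigma>\<in>?S. G \<sigma> * G (c \<circ> \<sigma>)) = 4 * (\<Sum>\<sigma>\<in>?S. F \<sigma> * G (c \<circ> \<sigma>))"
    by (rule sum_G) (simp_all add: conj[THEN k] comp_assoc G_inv)
  moreover have "(\<Sum>\<sigma>\<in>?S. G \<sigma> * G \<sigma>) = 4 * (\<Sum>\<sigma>\<in>?S. F \<sigma> * G \<sigma>)"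
    by (rule sum_G) (simp_all add: G_inv)
  ultimately have "(\<Sum>\<sigma>\<in>?S. F \<sigma> * G (c \<circ> \<sigma>)) \<le> (\<Sum>\<sigma>\<in>?S. F \<sigma> * G \<sigma>)" by simp
  moreover have "(\<Sum>\<sigma>\<in>?S. F \<sigma> * G (c \<circ> \<sigma>)) =
      corr V F id c + corr V F id (d1 \<circ> c) + corr V F id (d2 \<circ> c) + corr V F id (d3 \<circ> c)"
    by (simp add: corr_def G_def distrib_left sum.distrib comp_assoc)
  moreover have "(\<Sum>\<sigma>\<in>?S. F \<sigma> * G \<sigma>) = corr V F id id + corr V F id d1 + corr V F id d2 + corr V F id d3"
    by (simp add: corr_def G_def distrib_left sum.distrib)
  ultimately show ?thesis
    unfolding cyc unfolding ds c_def using V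
    by (simp add: corr_transpose_transpose corr_commute)
qed

text \<open>The square is no longer exactly \<open>d\<^sup>2\<close> times the norm. The deficit is
  \<open>2 * k\<close> times the difference of the two sides of
  \<open>klein_corr_bound\<close>.\<close>

lemma octopus_3:
  fixes F :: "('a \<Rightarrow> 'a) \<Rightarrow> real" and a b c :: real
  assumes V: "x \<in> V" "p \<in> V" "q \<in> V" "r \<in> V"
    and ne: "x \<noteq> p" "x \<noteq> q" "x \<noteq> r" "p \<noteq> q" "p \<noteq> r" "q \<noteq> r"
    and pos: "0 \<le> a" "0 \<le> b" "0 \<le> c"
  shows "(\<Sum>\<sigma> | \<sigma> permutes V. a * b * (F \<sigma> - F (transpose p q \<circ> \<sigma>))\<^sup>2
      + a * c * (F \<sigma> - F (transpose p r \<circ> \<sigma>))\<^sup>2 + b * c * (F \<sigma> - F (transpose q r \<circ> \<sigma>))\<^sup>2) \<le>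
    (a + b + c) * (\<Sum>\<sigma> | \<sigma> permutes V. a * (F \<sigma> - F (transpose x p \<circ> \<sigma>))\<^sup>2
      + b * (F \<sigma> - F (transpose x q \<circ> \<sigma>))\<^sup>2 + c * (F \<sigma> - F (transpose x r \<circ> \<sigma>))\<^sup>2)"
proof -
  let ?S = "{\<sigma>. \<sigma> permutes V}"
  let ?X = "\<lambda>p \<sigma>. F (transpose x p \<circ> \<sigma>)" and ?Y = "\<lambda>p q \<sigma>. F (transpose p q \<circ> \<sigma>)"
  define s where "s = a + b + c"
  define d where "d = s\<^sup>2 - a * b - a * c - b * c"
  define k where "k = s * a * b * c"
  define B where "B \<sigma> = s * a * ?X p \<sigma> + s * b * ?X q \<sigma> + s * c * ?X r \<sigma>
    - a * b * ?Y p q \<sigma> - a * c * ?Y p r \<sigma> - b * c * ?Y q r \<sigma>" for \<sigma>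
  have "d = a\<^sup>2 + b\<^sup>2 + c\<^sup>2 + a * b + a * c + b * c"
    unfolding d_def s_def by (simp add: power2_sum algebra_simps)
  then have d: "0 \<le> d" using pos by simp
  have k: "0 \<le> k" using pos by (simp add: k_def s_def)
  define N where "N = corr V F id id"
  define C D where "C i j l = corr V F (transpose i j) (transpose i l)"
    and "D i j l = corr V F (transpose x i) (transpose j l)" for i j l
  have tri: "corr V F (transpose i l) (transpose j l) = C i j l" "corr V F (transpose i j) (transpose j l) = C i j l"
    if "{i, j, l} \<subseteq> V" "i \<noteq> j" "i \<noteq> l" "j \<noteq> l" for i j l
    unfolding C_def using corr_triangle[of i V j l F] that by (auto simp: corr_commute)
  have "(\<Sum>\<sigma>\<in>?S. (B \<sigma>)\<^sup>2) =
      (s * a)\<^sup>2 * corr V F (transpose x p) (transpose x p) + (s * b)\<^sup>2 * corr V F (transpose x q) (transpose x q)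
      + (s * c)\<^sup>2 * corr V F (transpose x r) (transpose x r)
      + (a * b)\<^sup>2 * corr V F (transpose p q) (transpose p q)
      + (a * c)\<^sup>2 * corr V F (transpose p r) (transpose p r)
      + (b * c)\<^sup>2 * corr V F (transpose q r) (transpose q r)
      + 2 * (s * a) * (s * b) * corr V F (transpose x p) (transpose x q)
      + 2 * (s * a) * (s * c) * corr V F (transpose x p) (transpose x r)
      + 2 * (s * b) * (s * c) * corr V F (transpose x q) (transpose x r)
      + 2 * (a * b) * (a * c) * corr V F (transpose p q) (transpose p r)
      + 2 * (a * b) * (b * c) * corr V F (transpose p q) (transpose q r)
      + 2 * (a * c) * (b * c) * corr V F (transpose p r) (transpose q r)
      - 2 * (s * a) * (a * b) * corr V F (transpose x p) (transpose p q)
      - 2 * (s * a) * (a * c) * corr V F (transpose x p) (transpose p r)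
      - 2 * (s * a) * (b * c) * corr V F (transpose x p) (transpose q r)
      - 2 * (s * b) * (a * b) * corr V F (transpose x q) (transpose p q)
      - 2 * (s * b) * (a * c) * corr V F (transpose x q) (transpose p r)
      - 2 * (s * b) * (b * c) * corr V F (transpose x q) (transpose q r)
      - 2 * (s * c) * (a * b) * corr V F (transpose x r) (transpose p q)
      - 2 * (s * c) * (a * c) * corr V F (transpose x r) (transpose p r)
      - 2 * (s * c) * (b * c) * corr V F (transpose x r) (transpose q r)"
    unfolding corr_def sum_distrib_left sum.distrib[symmetric] sum_subtractf[symmetric]
    by (intro sum.cong refl) (simp add: B_def power2_eq_square algebra_simps)
  also have "\<dots> = ((s * a)\<^sup>2 + (s * b)\<^sup>2 + (s * c)\<^sup>2 + (a * b)\<^sup>2 + (a * c)\<^sup>2 + (b * c)\<^sup>2) * N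
      + 2 * (a * b * s) * (s - a - b) * C x p q + 2 * (a * c * s) * (s - a - c) * C x p r
      + 2 * (b * c * s) * (s - b - c) * C x q r + 2 * (a * b * c) * (a + b + c) * C p q r
      - 2 * k * (D p q r + D q p r + D r p q)"
  proof -
    have t: "corr V F (transpose x p) (transpose p q) = C x p q" "corr V F (transpose x q) (transpose p q) = C x p q"
      "corr V F (transpose x p) (transpose p r) = C x p r" "corr V F (transpose x r) (transpose p r) = C x p r"
      "corr V F (transpose x q) (transpose q r) = C x q r" "corr V F (transpose x r) (transpose q r) = C x q r"
      "corr V F (transpose p q) (transpose q r) = C p q r" "corr V F (transpose p r) (transpose q r) = C p q r"
      using tri[of x p q] tri[of x p r] tri[of x q r] tri[of p q r] V ne by auto
    have t': "corr V F (transpose x p) (transpose x q) = C x p q" "corr V F (transpose x p) (transpose x r) = C x p r"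
      "corr V F (transpose x q) (transpose x r) = C x q r" "corr V F (transpose p q) (transpose p r) = C p q r"
      "corr V F (transpose x p) (transpose q r) = D p q r" "corr V F (transpose x q) (transpose p r) = D q p r"
      "corr V F (transpose x r) (transpose p q) = D r p q"
      by (simp_all add: C_def D_def)
    show ?thesis
      unfolding t t' corr_same[OF V(1,2)] corr_same[OF V(1,3)] corr_same[OF V(1,4)]
        corr_same[OF V(2,3)] corr_same[OF V(2,4)] corr_same[OF V(3,4)] N_def[symmetric]
      by (simp add: k_def power2_eq_square algebra_simps)
  qed
  \<comment> \<open>Since \<open>s = a + b + c\<close>, each factor such as \<open>s - a - b\<close>
    is the remaining weight, so all four 3-cycle terms get the same coefficient
    \<open>2 * k\<close>.\<close>
  also have "\<dots> = (d\<^sup>2 - 2 * k) * N + 2 * k * (C p q r + C x p r + C x p q + C x q r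
      - D p q r - D q p r - D r p q)"
    by (simp add: d_def k_def s_def power2_eq_square algebra_simps)
  also have "\<dots> \<le> (d\<^sup>2 - 2 * k) * N + 2 * k * N"
  proof -
    have "C p q r + C x p r + C x p q + C x q r - D p q r - D q p r - D r p q \<le> N"
      using klein_corr_bound[OF V ne, of F] tri[of x p q] tri[of x p r] tri[of x q r] tri[of p q r] V ne
      by (simp add: D_def N_def corr_commute)
    then show ?thesis using k by (simp add: mult_left_mono)
  qed
  also have "\<dots> = d\<^sup>2 * (\<Sum>\<sigma>\<in>?S. (F \<sigma>)\<^sup>2)" by (simp add: N_def corr_def power2_eq_square algebra_simps)
  finally have "(\<Sum>\<sigma>\<in>?S. F \<sigma> * B \<sigma>) \<le> d * (\<Sum>\<sigma>\<in>?S. (F \<sigma>)\<^sup>2)"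
    using d by (intro sum_mult_le_of_square_le) auto
  moreover have "(\<Sum>\<sigma>\<in>?S. F \<sigma> * B \<sigma>) =
      s * a * corr V F id (transpose x p) + s * b * corr V F id (transpose x q) + s * c * corr V F id (transpose x r)
      - a * b * corr V F id (transpose p q) - a * c * corr V F id (transpose p r) - b * c * corr V F id (transpose q r)"
    unfolding corr_def sum_distrib_left sum.distrib[symmetric] sum_subtractf[symmetric]
    by (intro sum.cong refl) (simp add: B_def algebra_simps)
  moreover have "(\<Sum>\<sigma>\<in>?S. (F \<sigma>)\<^sup>2) = N" by (simp add: N_def corr_def power2_eq_square)
  ultimately show ?thesis
    using V by (simp add: sum.distrib sum_square_diff_transpose flip: sum_distrib_left)
      (simp add: N_def[symmetric] d_def s_def power2_eq_square algebra_simps)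
qed

section \<open>Random walk and interchange Laplacians\<close>

text \<open>\<open>rw_laplacian\<close> on an arbitrary vertex set, since the induction removes
  vertices.\<close>

definition rw_lap :: "'a set \<Rightarrow> ('a \<Rightarrow> 'a \<Rightarrow> real) \<Rightarrow> 'a \<Rightarrow> 'a \<Rightarrow> real" where
  "rw_lap V \<alpha> i j = (if i = j then \<Sum>k\<in>V - {j}. \<alpha> k j else - \<alpha> i j)"

text \<open>Diagonal weights need not vanish: \<open>reduced_weights\<close> creates them, and they
  contribute to neither Laplacian.\<close>

definition weights_on :: "'a set \<Rightarrow> ('a \<Rightarrow> 'a \<Rightarrow> real) \<Rightarrow> bool" where
  "weights_on V \<alpha> \<longleftrightarrow> (\<forall>i\<in>V. \<forall>j\<in>V. \<alpha> i j = \<alpha> j i \<and> 0 \<le> \<alpha> i j)"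

lemma weights_onD:
  assumes "weights_on V \<alpha>" "i \<in> V" "j \<in> V"
  shows "\<alpha> i j = \<alpha> j i" "0 \<le> \<alpha> i j"
  using assms unfolding weights_on_def by blast+

definition rw_form :: "'a set \<Rightarrow> ('a \<Rightarrow> 'a \<Rightarrow> real) \<Rightarrow> ('a \<Rightarrow> real) \<Rightarrow> real" where
  "rw_form V \<alpha> g = (\<Sum>i\<in>V. \<Sum>j\<in>V. \<alpha> i j * (g i - g j)\<^sup>2)"

lemma rw_lap_apply:
  assumes V: "finite V" "weights_on V \<alpha>" and i: "i \<in> V"
  shows "(\<Sum>j\<in>V. rw_lap V \<alpha> i j * g j) = (\<Sum>j\<in>V. \<alpha> i j * (g i - g j))"
proof -
  have "(\<Sum>j\<in>V. rw_lap V \<alpha> i j * g j) =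
      (\<Sum>k\<in>V - {i}. \<alpha> k i) * g i + (\<Sum>j\<in>V - {i}. rw_lap V \<alpha> i j * g j)"
    using V i by (subst sum.remove[of V i]) (auto simp: rw_lap_def)
  also have "(\<Sum>k\<in>V - {i}. \<alpha> k i) = (\<Sum>k\<in>V - {i}. \<alpha> i k)"
    using weights_onD(1)[OF V(2)] i by (intro sum.cong) auto
  also have "(\<Sum>j\<in>V - {i}. rw_lap V \<alpha> i j * g j) = (\<Sum>j\<in>V - {i}. - \<alpha> i j * g j)"
    by (intro sum.cong) (auto simp: rw_lap_def)
  also have "(\<Sum>k\<in>V - {i}. \<alpha> i k) * g i + \<dots> = (\<Sum>j\<in>V - {i}. \<alpha> i j * (g i - g j))"
    by (simp add: sum_distrib_right sum_subtractf sum_negf right_diff_distrib)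
  also have "\<dots> = (\<Sum>j\<in>V. \<alpha> i j * (g i - g j))"
    using V i by (simp add: sum.remove[of V i])
  finally show ?thesis .
qed

lemma symmetric_zero_sums_rw_lap:
  assumes "finite V" "weights_on V \<alpha>"
  shows "symmetric_zero_sums V (rw_lap V \<alpha>)"
  using rw_lap_apply[OF assms, where g = "\<lambda>_. 1"] weights_onD(1)[OF assms(2)]
  by (auto simp: symmetric_zero_sums_def rw_lap_def)

lemma bilin_rw_lap:
  assumes "finite V" "weights_on V \<alpha>"
  shows "bilin V (rw_lap V \<alpha>) g g = rw_form V \<alpha> g / 2"
proof -
  define S where "S = (\<Sum>i\<in>V. \<Sum>j\<in>V. \<alpha> i j * g i * (g i - g j))"
  have "g i * (\<Sum>j\<in>V. rw_lap V \<alpha> i j * g j) = (\<Sum>j\<in>V. \<alpha> i j * g i * (g i - g j))" if "i \<in> V" for i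
    unfolding rw_lap_apply[OF assms that] sum_distrib_left by (simp add: mult_ac)
  then have "bilin V (rw_lap V \<alpha>) g g = S"
    unfolding bilin_def S_def by (intro sum.cong refl)
  moreover have "S = (\<Sum>j\<in>V. \<Sum>i\<in>V. \<alpha> i j * g i * (g i - g j))"
    unfolding S_def by (rule sum.swap)
  then have "S = (\<Sum>i\<in>V. \<Sum>j\<in>V. \<alpha> i j * g j * (g j - g i))"
    using weights_onD(1)[OF assms(2)] by (simp cong: sum.cong)
  then have "S + S = rw_form V \<alpha> g"
    unfolding rw_form_def
    by (subst S_def) (simp add: sum.distrib[symmetric] power2_eq_square algebra_simps)
  ultimately show ?thesis by simp
qed

text \<open>Off the diagonal this is the Schur complement of the Laplacian at \<open>x\<close>, the
  star-mesh transformation of electrical networks. If all weights at \<open>x\<close> vanish,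
  division by 0 gives 0 and the other weights stay as they are.\<close>

definition reduced_weights :: "'a set \<Rightarrow> 'a \<Rightarrow> ('a \<Rightarrow> 'a \<Rightarrow> real) \<Rightarrow> 'a \<Rightarrow> 'a \<Rightarrow> real" where
  "reduced_weights V x \<alpha> i j = \<alpha> i j + \<alpha> i x * \<alpha> x j / (\<Sum>y\<in>V - {x}. \<alpha> x y)"

lemma weights_on_reduced:
  assumes "weights_on V \<alpha>" "x \<in> V"
  shows "weights_on (V - {x}) (reduced_weights V x \<alpha>)"
  using assms weights_onD[OF assms(1)]
  by (auto simp: weights_on_def reduced_weights_def intro!: add_nonneg_nonneg divide_nonneg_nonneg
      mult_nonneg_nonneg sum_nonneg)

text \<open>The value at \<open>x\<close> is the harmonic one, which minimizes the energy.\<close>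

lemma rw_form_harmonic_extension:
  assumes V: "finite V" "weights_on V \<alpha>" "x \<in> V"
  obtains h where "rw_form V \<alpha> (g(x := h)) = rw_form (V - {x}) (reduced_weights V x \<alpha>) g"
proof
  let ?W = "V - {x}"
  \<comment> \<open>Total weight, first moment and second moment of \<open>g\<close> under the
    weights at \<open>x\<close>. The witness is the weighted mean \<open>m / s\<close>; both
    energies exceed that of the remaining edges by twice \<open>q - m\<^sup>2 / s\<close>.\<close>
  define s where "s = (\<Sum>y\<in>?W. \<alpha> x y)"
  define m where "m = (\<Sum>y\<in>?W. \<alpha> x y * g y)"
  define q where "q = (\<Sum>y\<in>?W. \<alpha> x y * (g y)\<^sup>2)"
  have sym: "\<alpha> y x = \<alpha> x y" if "y \<in> ?W" for y using weights_onD(1)[OF V(2)] V(3) that by auto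
  have var: "(\<Sum>j\<in>?W. \<alpha> x j * (c - g j)\<^sup>2) = q - 2 * c * m + c\<^sup>2 * s" for c
    unfolding q_def m_def s_def sum_distrib_left sum.distrib[symmetric] sum_subtractf[symmetric]
    by (intro sum.cong refl) (simp add: power2_eq_square algebra_simps)
  have "rw_form V \<alpha> (g(x := m / s)) = (\<Sum>i\<in>V. \<alpha> i x * ((g(x := m / s)) i - m / s)\<^sup>2
      + (\<Sum>j\<in>?W. \<alpha> i j * ((g(x := m / s)) i - g j)\<^sup>2))"
    unfolding rw_form_def
  proof (rule sum.cong[OF refl])
    fix i
    show "(\<Sum>j\<in>V. \<alpha> i j * ((g(x := m / s)) i - (g(x := m / s)) j)\<^sup>2) = \<alpha> i x * ((g(x := m / s)) i - m / s)\<^sup>2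
      + (\<Sum>j\<in>?W. \<alpha> i j * ((g(x := m / s)) i - g j)\<^sup>2)"
      using V by (subst sum.remove[of V x]) auto
  qed
  also have "\<dots> = (\<Sum>j\<in>?W. \<alpha> x j * (m / s - g j)\<^sup>2) + (\<Sum>i\<in>?W. \<alpha> i x * (g i - m / s)\<^sup>2)
      + rw_form ?W \<alpha> g"
    using V by (subst sum.remove[of V x]) (auto simp: sum.distrib rw_form_def)
  also have "(\<Sum>i\<in>?W. \<alpha> i x * (g i - m / s)\<^sup>2) = (\<Sum>j\<in>?W. \<alpha> x j * (m / s - g j)\<^sup>2)"
    by (intro sum.cong) (auto simp: sym power2_commute)
  also have "\<dots> = q - 2 * (m / s) * m + (m / s)\<^sup>2 * s"
    by (rule var)
  finally have ext: "rw_form V \<alpha> (g(x := m / s)) = 2 * (q - 2 * (m / s) * m + (m / s)\<^sup>2 * s) + rw_form ?W \<alpha> g"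
    unfolding mult_2[of "q - 2 * (m / s) * m + (m / s)\<^sup>2 * s"] .
  have "(\<Sum>i\<in>?W. \<Sum>j\<in>?W. \<alpha> x i * \<alpha> x j * (g i - g j)\<^sup>2) =
      (\<Sum>i\<in>?W. (\<alpha> x i * (g i)\<^sup>2) * s - 2 * (\<alpha> x i * g i) * m + \<alpha> x i * q)"
    unfolding s_def m_def q_def sum_distrib_left sum.distrib[symmetric] sum_subtractf[symmetric]
    by (intro sum.cong refl) (simp add: power2_eq_square algebra_simps)
  also have "\<dots> = (\<Sum>i\<in>?W. \<alpha> x i * (g i)\<^sup>2) * s - 2 * (\<Sum>i\<in>?W. \<alpha> x i * g i) * m + (\<Sum>i\<in>?W. \<alpha> x i) * q"
    by (simp add: sum.distrib sum_subtractf sum_distrib_left sum_distrib_right mult.assoc)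
  also have "\<dots> = 2 * q * s - 2 * m\<^sup>2"
    unfolding s_def[symmetric] m_def[symmetric] q_def[symmetric] by (simp add: power2_eq_square)
  finally have pairs: "(\<Sum>i\<in>?W. \<Sum>j\<in>?W. \<alpha> x i * \<alpha> x j * (g i - g j)\<^sup>2) = 2 * q * s - 2 * m\<^sup>2" .
  have "rw_form ?W (reduced_weights V x \<alpha>) g =
      (\<Sum>i\<in>?W. \<Sum>j\<in>?W. \<alpha> i j * (g i - g j)\<^sup>2 + \<alpha> x i * \<alpha> x j * (g i - g j)\<^sup>2 / s)"
    unfolding rw_form_def
    by (intro sum.cong refl) (simp add: reduced_weights_def s_def[symmetric] sym algebra_simps)
  also have "\<dots> = rw_form ?W \<alpha> g + (2 * q * s - 2 * m\<^sup>2) / s"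
    by (simp add: sum.distrib rw_form_def pairs flip: sum_divide_distrib)
  finally have red: "rw_form ?W (reduced_weights V x \<alpha>) g = rw_form ?W \<alpha> g + (2 * q * s - 2 * m\<^sup>2) / s" .
  show "rw_form V \<alpha> (g(x := m / s)) = rw_form (V - {x}) (reduced_weights V x \<alpha>) g"
  proof (cases "s = 0")
    \<comment> \<open>All weights at \<open>x\<close> vanish here, so \<open>q = 0\<close>, and
      every quotient by \<open>s\<close> is 0 by convention.\<close>
    case True
    then have "\<forall>y\<in>?W. \<alpha> x y = 0"
      using V weights_onD(2)[OF V(2)] unfolding s_def by (subst (asm) sum_nonneg_eq_0_iff) auto
    then have "q = 0" by (simp add: q_def)
    then show ?thesis using True ext red by simp
  next
    case False
    then show ?thesis unfolding ext red by (simp add: field_simps power2_eq_square)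
  qed
qed

text \<open>The harmonic extension of \<open>g\<close> keeps the energy, as does recentring it. The
  squared norm changes by \<open>h\<^sup>2 - t * h\<close>, which is nonnegative because
  \<open>t\<close> is \<open>h\<close> divided by the number of vertices.\<close>

lemma poincare_reduced:
  assumes V: "finite V" "weights_on V \<alpha>" "x \<in> V" and l: "0 \<le> l" "poincare V (rw_lap V \<alpha>) l"
  shows "poincare (V - {x}) (rw_lap (V - {x}) (reduced_weights V x \<alpha>)) l"
  unfolding poincare_def
proof (intro allI impI)
  fix g :: "'a \<Rightarrow> real"
  assume g: "(\<Sum>i\<in>V - {x}. g i) = 0"
  obtain h where h: "rw_form V \<alpha> (g(x := h)) = rw_form (V - {x}) (reduced_weights V x \<alpha>) g"
    using rw_form_harmonic_extension[OF V] .
  define u where "u = g(x := h)"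
  have u: "(\<Sum>i\<in>V. u i) = h" "(\<Sum>i\<in>V. (u i)\<^sup>2) = h\<^sup>2 + (\<Sum>i\<in>V - {x}. (g i)\<^sup>2)"
    using V g by (auto simp: u_def sum.remove[of V x])
  define t where "t = h / card V"
  have card: "card V > 0" using V by (auto simp: card_gt_0_iff)
  then have t: "card V * t = h" by (simp add: t_def)
  have "(\<Sum>i\<in>V. (u i - t)\<^sup>2) = (\<Sum>i\<in>V. (u i)\<^sup>2) - 2 * t * (\<Sum>i\<in>V. u i) + (\<Sum>i\<in>V. t\<^sup>2)"
    unfolding sum_distrib_left sum.distrib[symmetric] sum_subtractf[symmetric]
    by (intro sum.cong refl) (simp add: power2_eq_square algebra_simps)
  also have "\<dots> = h\<^sup>2 + (\<Sum>i\<in>V - {x}. (g i)\<^sup>2) - t * h"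
    using t unfolding u by (simp add: power2_eq_square)
  finally have nrm: "(\<Sum>i\<in>V. (u i - t)\<^sup>2) = h\<^sup>2 + (\<Sum>i\<in>V - {x}. (g i)\<^sup>2) - t * h" .
  have "t * h \<le> h\<^sup>2" using card by (simp add: t_def power2_eq_square divide_le_eq mult_le_cancel_left1)
  then have "l * (\<Sum>i\<in>V - {x}. (g i)\<^sup>2) \<le> l * (\<Sum>i\<in>V. (u i - t)\<^sup>2)"
    using l unfolding nrm by (intro mult_left_mono) auto
  also have "\<dots> \<le> bilin V (rw_lap V \<alpha>) (\<lambda>i. u i - t) (\<lambda>i. u i - t)"
    using l t u by (simp add: poincare_def sum_subtractf)
  also have "\<dots> = rw_form V \<alpha> u / 2"
    unfolding bilin_rw_lap[OF V(1,2)] by (simp add: rw_form_def)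
  also have "\<dots> = bilin (V - {x}) (rw_lap (V - {x}) (reduced_weights V x \<alpha>)) g g"
    using h V weights_on_reduced[OF V(2,3)] by (subst bilin_rw_lap) (auto simp: u_def)
  finally show "l * (\<Sum>i\<in>V - {x}. (g i)\<^sup>2) \<le> bilin (V - {x}) (rw_lap (V - {x}) (reduced_weights V x \<alpha>)) g g" .
qed

section \<open>The interchange Laplacian and its energy form\<close>

definition ip_lap :: "nat set \<Rightarrow> (nat \<Rightarrow> nat \<Rightarrow> real) \<Rightarrow> (nat \<Rightarrow> nat) \<Rightarrow> (nat \<Rightarrow> nat) \<Rightarrow> real" where
  "ip_lap V \<alpha> \<sigma> \<sigma>' =
     (if \<sigma> = \<sigma>' then \<Sum>(i, j) | i \<in> V \<and> j \<in> V \<and> i < j. \<alpha> i j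
      else - (\<Sum>(i, j) | (i \<in> V \<and> j \<in> V \<and> i < j) \<and> \<sigma>' = transpose i j \<circ> \<sigma>. \<alpha> i j))"

text \<open>Two vertex sets are needed because the reduced weights, which live on \<open>V\<close>
  without \<open>x\<close>, are also applied to functions of all permutations of
  \<open>V\<close>.\<close>

definition ip_form :: "'a set \<Rightarrow> 'a set \<Rightarrow> ('a \<Rightarrow> 'a \<Rightarrow> real) \<Rightarrow> (('a \<Rightarrow> 'a) \<Rightarrow> real) \<Rightarrow> real" where
  "ip_form V W \<alpha> F = (\<Sum>\<sigma> | \<sigma> permutes V. \<Sum>i\<in>W. \<Sum>j\<in>W. \<alpha> i j * (F \<sigma> - F (transpose i j \<circ> \<sigma>))\<^sup>2)"

lemma sum_sum_symmetric:
  fixes h :: "nat \<Rightarrow> nat \<Rightarrow> real"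
  assumes V: "finite V" and sym: "\<And>i j. i \<in> V \<Longrightarrow> j \<in> V \<Longrightarrow> h i j = h j i" and diag: "\<And>i. i \<in> V \<Longrightarrow> h i i = 0"
  shows "(\<Sum>i\<in>V. \<Sum>j\<in>V. h i j) = 2 * (\<Sum>(i, j) | i \<in> V \<and> j \<in> V \<and> i < j. h i j)"
proof -
  let ?P = "{(i, j). i \<in> V \<and> j \<in> V \<and> i < j}"
  let ?Q = "{(i, j). i \<in> V \<and> j \<in> V \<and> j < i}"
  let ?D = "{(i, j). i \<in> V \<and> j \<in> V \<and> i = j}"
  have fin: "finite ?P" "finite ?Q" "finite ?D"
    by (rule finite_subset[of _ "V \<times> V"], use V in auto)+
  have "(\<Sum>i\<in>V. \<Sum>j\<in>V. h i j) = (\<Sum>(i, j)\<in>V \<times> V. h i j)"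
    using V by (simp add: sum.cartesian_product)
  also have "V \<times> V = ?P \<union> (?Q \<union> ?D)" by auto
  also have "(\<Sum>(i, j)\<in>?P \<union> (?Q \<union> ?D). h i j) = (\<Sum>(i, j)\<in>?P. h i j) + ((\<Sum>(i, j)\<in>?Q. h i j) + (\<Sum>(i, j)\<in>?D. h i j))"
    using fin by (subst sum.union_disjoint; (subst sum.union_disjoint)?) auto
  also have "(\<Sum>(i, j)\<in>?D. h i j) = 0" by (rule sum.neutral) (auto simp: diag)
  also have "(\<Sum>(i, j)\<in>?Q. h i j) = (\<Sum>(i, j)\<in>?P. h i j)"
    by (rule sum.reindex_bij_witness[of _ prod.swap prod.swap]) (auto simp: sym)
  finally show ?thesis by simp
qed

lemma ip_lap_apply:
  assumes V: "finite V" "weights_on V \<alpha>" and \<sigma>: "\<sigma> permutes V"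
  shows "(\<Sum>\<tau> | \<tau> permutes V. ip_lap V \<alpha> \<sigma> \<tau> * F \<tau>) =
    (\<Sum>i\<in>V. \<Sum>j\<in>V. \<alpha> i j * (F \<sigma> - F (transpose i j \<circ> \<sigma>))) / 2"
proof -
  let ?S = "{\<sigma>. \<sigma> permutes V}"
  let ?P = "{(i, j). i \<in> V \<and> j \<in> V \<and> i < j}"
  have fin: "finite ?P" by (rule finite_subset[of _ "V \<times> V"]) (use V in auto)
  have finS: "finite ?S" using V by (simp add: finite_permutations)
  \<comment> \<open>Hence the off-diagonal sum vanishes on the diagonal, and a matrix entry is a
    plain difference of two terms without a case split.\<close>
  have ne: "\<sigma> \<noteq> transpose i j \<circ> \<sigma>" if "i < j" for i j
  proof
    assume *: "\<sigma> = transpose i j \<circ> \<sigma>"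
    obtain k where k: "\<sigma> k = i" using permutes_surj[OF \<sigma>] by (metis surjD)
    have "transpose i j (\<sigma> k) = \<sigma> k" by (subst (2) *) simp
    then show False using that unfolding k by simp
  qed
  have "ip_lap V \<alpha> \<sigma> \<tau> = (if \<tau> = \<sigma> then \<Sum>(i, j)\<in>?P. \<alpha> i j else 0)
      - (\<Sum>(i, j)\<in>?P. if \<tau> = transpose i j \<circ> \<sigma> then \<alpha> i j else 0)" for \<tau>
  proof -
    have "(\<Sum>(i, j) | (i \<in> V \<and> j \<in> V \<and> i < j) \<and> \<tau> = transpose i j \<circ> \<sigma>. \<alpha> i j) =
        (\<Sum>p | p \<in> ?P \<and> \<tau> = transpose (fst p) (snd p) \<circ> \<sigma>. \<alpha> (fst p) (snd p))"
      by (intro sum.cong) auto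
    also have "\<dots> = (\<Sum>p\<in>?P. if \<tau> = transpose (fst p) (snd p) \<circ> \<sigma> then \<alpha> (fst p) (snd p) else 0)"
      using fin by (subst sum.inter_filter[symmetric]) auto
    finally have 1: "(\<Sum>(i, j) | (i \<in> V \<and> j \<in> V \<and> i < j) \<and> \<tau> = transpose i j \<circ> \<sigma>. \<alpha> i j) =
        (\<Sum>(i, j)\<in>?P. if \<tau> = transpose i j \<circ> \<sigma> then \<alpha> i j else 0)"
      by (simp add: case_prod_beta)
    show ?thesis
    proof (cases "\<tau> = \<sigma>")
      case True
      have "(\<Sum>(i, j)\<in>?P. if \<tau> = transpose i j \<circ> \<sigma> then \<alpha> i j else 0) = 0"
        using True ne by (intro sum.neutral) auto
      then show ?thesis using True by (simp add: ip_lap_def)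
    next
      case False
      then show ?thesis using 1 by (simp add: ip_lap_def)
    qed
  qed
  then have "(\<Sum>\<tau>\<in>?S. ip_lap V \<alpha> \<sigma> \<tau> * F \<tau>) = (\<Sum>\<tau>\<in>?S. if \<tau> = \<sigma> then (\<Sum>(i, j)\<in>?P. \<alpha> i j) * F \<sigma> else 0)
      - (\<Sum>\<tau>\<in>?S. (\<Sum>(i, j)\<in>?P. if \<tau> = transpose i j \<circ> \<sigma> then \<alpha> i j else 0) * F \<tau>)"
    unfolding sum_subtractf[symmetric] by (intro sum.cong refl) (simp add: left_diff_distrib)
  also have "(\<Sum>\<tau>\<in>?S. if \<tau> = \<sigma> then (\<Sum>(i, j)\<in>?P. \<alpha> i j) * F \<sigma> else 0) = (\<Sum>(i, j)\<in>?P. \<alpha> i j) * F \<sigma>"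
    using finS \<sigma> by simp
  also have "(\<Sum>\<tau>\<in>?S. (\<Sum>(i, j)\<in>?P. if \<tau> = transpose i j \<circ> \<sigma> then \<alpha> i j else 0) * F \<tau>) =
      (\<Sum>(i, j)\<in>?P. \<Sum>\<tau>\<in>?S. if \<tau> = transpose i j \<circ> \<sigma> then \<alpha> i j * F \<tau> else 0)"
    unfolding sum_distrib_right case_prod_beta
    by (subst sum.swap) (intro sum.cong refl, simp)
  also have "\<dots> = (\<Sum>(i, j)\<in>?P. \<alpha> i j * F (transpose i j \<circ> \<sigma>))"
    using finS \<sigma> by (intro sum.cong refl)
      (auto intro!: permutes_compose permutes_swap_id simp del: o_apply)
  also have "(\<Sum>(i, j)\<in>?P. \<alpha> i j) * F \<sigma> - \<dots> = (\<Sum>(i, j)\<in>?P. \<alpha> i j * (F \<sigma> - F (transpose i j \<circ> \<sigma>)))"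
    unfolding sum_distrib_right sum_subtractf[symmetric]
    by (intro sum.cong refl) (auto simp: right_diff_distrib)
  also have "\<dots> = (\<Sum>i\<in>V. \<Sum>j\<in>V. \<alpha> i j * (F \<sigma> - F (transpose i j \<circ> \<sigma>))) / 2"
    using V weights_onD(1)[OF V(2)]
    by (subst sum_sum_symmetric) (auto simp: transpose_commute)
  finally show ?thesis .
qed

lemma symmetric_zero_sums_ip_lap:
  assumes V: "finite V" "weights_on V \<alpha>"
  shows "symmetric_zero_sums {\<sigma>. \<sigma> permutes V} (ip_lap V \<alpha>)"
proof -
  have eq: "\<sigma> = transpose i j \<circ> \<tau>" if "\<tau> = transpose i j \<circ> \<sigma>" for i j and \<sigma> \<tau> :: "nat \<Rightarrow> nat"
    unfolding that by (simp add: comp_assoc[symmetric])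
  have "ip_lap V \<alpha> \<sigma> \<tau> = ip_lap V \<alpha> \<tau> \<sigma>" for \<sigma> \<tau>
  proof (cases "\<sigma> = \<tau>")
    case False
    have "{(i, j). (i \<in> V \<and> j \<in> V \<and> i < j) \<and> \<tau> = transpose i j \<circ> \<sigma>} =
        {(i, j). (i \<in> V \<and> j \<in> V \<and> i < j) \<and> \<sigma> = transpose i j \<circ> \<tau>}"
      using eq by blast
    then show ?thesis unfolding ip_lap_def using False by (simp del: o_apply)
  qed simp
  moreover have "(\<Sum>\<tau> | \<tau> permutes V. ip_lap V \<alpha> \<sigma> \<tau>) = 0" if "\<sigma> permutes V" for \<sigma>
    using ip_lap_apply[OF V that, where F = "\<lambda>_. 1"] by simp
  ultimately show ?thesis unfolding symmetric_zero_sums_def by blast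
qed

lemma sum_swap3: "(\<Sum>a\<in>A. \<Sum>b\<in>B. \<Sum>c\<in>C. h a b c) = (\<Sum>b\<in>B. \<Sum>c\<in>C. \<Sum>a\<in>A. h a b c)"
proof -
  have "(\<Sum>a\<in>A. \<Sum>b\<in>B. \<Sum>c\<in>C. h a b c) = (\<Sum>b\<in>B. \<Sum>a\<in>A. \<Sum>c\<in>C. h a b c)"
    by (rule sum.swap)
  also have "\<dots> = (\<Sum>b\<in>B. \<Sum>c\<in>C. \<Sum>a\<in>A. h a b c)"
    by (rule sum.cong[OF refl], rule sum.swap)
  finally show ?thesis .
qed

text \<open>The factor 4 collects two double counts: ordered pairs list every edge twice, and the
  sum over permutations meets each pair of neighbours from both ends.\<close>

lemma bilin_ip_lap:
  assumes V: "finite V" "weights_on V \<alpha>"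
  shows "bilin {\<sigma>. \<sigma> permutes V} (ip_lap V \<alpha>) F F = ip_form V V \<alpha> F / 4"
proof -
  let ?S = "{\<sigma>. \<sigma> permutes V}"
  have half: "(\<Sum>\<sigma>\<in>?S. (F \<sigma> - F (transpose i j \<circ> \<sigma>))\<^sup>2) = 2 * (\<Sum>\<sigma>\<in>?S. F \<sigma> * (F \<sigma> - F (transpose i j \<circ> \<sigma>)))"
    if "i \<in> V" "j \<in> V" for i j
    unfolding sum_square_diff_transpose[OF that] corr_def sum_distrib_left sum_subtractf[symmetric]
    by (intro sum.cong refl) (simp add: algebra_simps)
  have "bilin ?S (ip_lap V \<alpha>) F F = (\<Sum>\<sigma>\<in>?S. F \<sigma> * ((\<Sum>i\<in>V. \<Sum>j\<in>V. \<alpha> i j * (F \<sigma> - F (transpose i j \<circ> \<sigma>))) / 2))"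
    unfolding bilin_def by (intro sum.cong refl) (simp add: ip_lap_apply[OF V])
  also have "\<dots> = (\<Sum>\<sigma>\<in>?S. \<Sum>i\<in>V. \<Sum>j\<in>V. \<alpha> i j * (F \<sigma> * (F \<sigma> - F (transpose i j \<circ> \<sigma>)))) / 2"
    unfolding sum_divide_distrib sum_distrib_left by (intro sum.cong refl) simp
  also have "\<dots> = (\<Sum>i\<in>V. \<Sum>j\<in>V. \<Sum>\<sigma>\<in>?S. \<alpha> i j * (F \<sigma> * (F \<sigma> - F (transpose i j \<circ> \<sigma>)))) / 2"
    by (subst sum_swap3) (rule refl)
  also have "(\<Sum>i\<in>V. \<Sum>j\<in>V. \<Sum>\<sigma>\<in>?S. \<alpha> i j * (F \<sigma> * (F \<sigma> - F (transpose i j \<circ> \<sigma>)))) =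
      (\<Sum>i\<in>V. \<Sum>j\<in>V. (\<Sum>\<sigma>\<in>?S. \<alpha> i j * (F \<sigma> - F (transpose i j \<circ> \<sigma>))\<^sup>2) / 2)"
  proof (intro sum.cong refl)
    fix i j assume "i \<in> V" "j \<in> V"
    from half[OF this] show "(\<Sum>\<sigma>\<in>?S. \<alpha> i j * (F \<sigma> * (F \<sigma> - F (transpose i j \<circ> \<sigma>)))) =
        (\<Sum>\<sigma>\<in>?S. \<alpha> i j * (F \<sigma> - F (transpose i j \<circ> \<sigma>))\<^sup>2) / 2"
      unfolding sum_distrib_left[symmetric] by (simp del: o_apply)
  qed
  also have "\<dots> / 2 = ip_form V V \<alpha> F / 4"
    unfolding ip_form_def sum_divide_distrib[symmetric] by (subst (2) sum_swap3) simp
  finally show ?thesis .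
qed

section \<open>Cosets of a stabilizer and single-particle functions\<close>

lemma sum_permutes_split:
  assumes V: "finite V" "x \<in> V"
  shows "(\<Sum>\<sigma> | \<sigma> permutes V. h \<sigma>) = (\<Sum>k\<in>V. \<Sum>\<pi> | \<pi> permutes V - {x}. h (\<pi> \<circ> transpose x k))"
proof -
  \<comment> \<open>In \<open>sum_over_permutations_insert\<close> the transposition stands on the
    left. Inversion moves it to the right, so that left multiplication by permutations of
    \<open>V - {x}\<close> preserves each piece.\<close>
  have "(\<Sum>\<sigma> | \<sigma> permutes V. h \<sigma>) = (\<Sum>\<sigma> | \<sigma> permutes V. h (inv_into UNIV \<sigma>))"
    by (rule sum_permutations_inverse)
  also have "\<dots> = (\<Sum>k\<in>V. \<Sum>\<pi> | \<pi> permutes V - {x}. h (inv_into UNIV (transpose x k \<circ> \<pi>)))"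
    using sum_over_permutations_insert[of "V - {x}" x "\<lambda>\<sigma>. h (inv_into UNIV \<sigma>)"] V by (simp add: insert_absorb)
  also have "\<dots> = (\<Sum>k\<in>V. \<Sum>\<pi> | \<pi> permutes V - {x}. h (inv_into UNIV \<pi> \<circ> transpose x k))"
    by (intro sum.cong refl) (auto simp: o_inv_distrib permutes_bij)
  also have "\<dots> = (\<Sum>k\<in>V. \<Sum>\<pi> | \<pi> permutes V - {x}. h (\<pi> \<circ> transpose x k))"
    by (intro sum.cong refl sum_permutations_inverse[symmetric])
  finally show ?thesis .
qed

text \<open>Only transpositions that move \<open>v\<close> contribute, and \<open>v\<close> may be
  either entry of the ordered pair, whence the factor 2.\<close>

lemma sum_transpose_diff:
  fixes g :: "'a \<Rightarrow> real"
  assumes V: "finite V" "weights_on V \<alpha>" "v \<in> V"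
  shows "(\<Sum>i\<in>V. \<Sum>j\<in>V. \<alpha> i j * (g v - g (transpose i j v))) = 2 * (\<Sum>j\<in>V. \<alpha> v j * (g v - g j))"
proof -
  have "(\<Sum>i\<in>V. \<Sum>j\<in>V. \<alpha> i j * (g v - g (transpose i j v))) =
    (\<Sum>i\<in>V. \<Sum>j\<in>V. (if i = v then \<alpha> v j * (g v - g j) else 0) + (if j = v then \<alpha> v i * (g v - g i) else 0))"
    using weights_onD(1)[OF V(2)] V(3) by (intro sum.cong refl) (auto simp: transpose_def)
  also have "\<dots> = (\<Sum>i\<in>V. if i = v then (\<Sum>j\<in>V. \<alpha> v j * (g v - g j)) else 0) + (\<Sum>i\<in>V. \<alpha> v i * (g v - g i))"
  proof -
    have "(\<Sum>j\<in>V. (if i = v then \<alpha> v j * (g v - g j) else 0) + (if j = v then \<alpha> v i * (g v - g i) else 0)) =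
        (if i = v then (\<Sum>j\<in>V. \<alpha> v j * (g v - g j)) else 0) + \<alpha> v i * (g v - g i)" for i
      using V by (simp add: sum.distrib)
    then show ?thesis by (simp add: sum.distrib)
  qed
  also have "\<dots> = 2 * (\<Sum>j\<in>V. \<alpha> v j * (g v - g j))" using V by simp
  finally show ?thesis .
qed

text \<open>A single particle of the interchange process performs the random walk, so every random
  walk eigenvalue recurs and the interchange gap cannot be larger.\<close>

lemma eigenfunction_lift:
  assumes V: "finite V" "weights_on V \<alpha>" "x \<in> V" and f: "eigenfunction V (rw_lap V \<alpha>) l f"
  shows "eigenfunction {\<sigma>. \<sigma> permutes V} (ip_lap V \<alpha>) l (\<lambda>\<sigma>. f (\<sigma> x))"
  unfolding eigenfunction_def
proof (intro conjI ballI)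
  obtain i where i: "i \<in> V" "f i \<noteq> 0" using f by (auto simp: eigenfunction_def)
  then show "\<exists>\<sigma>\<in>{\<sigma>. \<sigma> permutes V}. f (\<sigma> x) \<noteq> 0"
    using V by (intro bexI[of _ "transpose x i"]) (auto intro: permutes_swap_id)
  have "(\<Sum>\<sigma> | \<sigma> permutes V. f (\<sigma> x)) = (\<Sum>b\<in>V. \<Sum>\<pi> | \<pi> permutes V - {x}. f ((transpose x b \<circ> \<pi>) x))"
    using sum_over_permutations_insert[of "V - {x}" x "\<lambda>\<sigma>. f (\<sigma> x)"] V by (simp add: insert_absorb)
  also have "\<dots> = (\<Sum>b\<in>V. \<Sum>\<pi> | \<pi> permutes V - {x}. f b)"
    by (intro sum.cong refl) (auto simp: permutes_not_in)
  also have "\<dots> = 0" using f by (simp add: eigenfunction_def flip: sum_distrib_left)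
  finally show "(\<Sum>\<sigma> | \<sigma> permutes V. f (\<sigma> x)) = 0" .
next
  fix \<sigma> assume "\<sigma> \<in> {\<sigma>. \<sigma> permutes V}"
  then have \<sigma>: "\<sigma> permutes V" by simp
  then have "\<sigma> x \<in> V" using V by (simp add: permutes_in_image)
  then show "(\<Sum>\<tau> | \<tau> permutes V. ip_lap V \<alpha> \<sigma> \<tau> * f (\<tau> x)) = l * f (\<sigma> x)"
    using f by (simp add: ip_lap_apply[OF V(1,2) \<sigma>] sum_transpose_diff[OF V(1,2)]
        rw_lap_apply[OF V(1,2)] eigenfunction_def)
qed

text \<open>Left translation by \<open>transpose i j\<close> carries the permutations with
  \<open>k\<close> at \<open>v\<close> to those with \<open>k\<close> at
  \<open>transpose i j v\<close>. Hence the marginal of one particle intertwines the two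
  Laplacians.\<close>

lemma eigenfunction_project:
  assumes V: "finite V" "weights_on V \<alpha>" and F: "eigenfunction {\<sigma>. \<sigma> permutes V} (ip_lap V \<alpha>) l F"
    and k: "k \<in> V" and nz: "v \<in> V" "(\<Sum>\<sigma> | \<sigma> permutes V \<and> \<sigma> k = v. F \<sigma>) \<noteq> 0"
  shows "eigenfunction V (rw_lap V \<alpha>) l (\<lambda>v. \<Sum>\<sigma> | \<sigma> permutes V \<and> \<sigma> k = v. F \<sigma>)"
proof -
  let ?S = "{\<sigma>. \<sigma> permutes V}"
  have fin: "finite ?S" using V by (simp add: finite_permutations)
  define P where "P H v = (\<Sum>\<sigma> | \<sigma> permutes V \<and> \<sigma> k = v. H \<sigma>)" for H :: "(nat \<Rightarrow> nat) \<Rightarrow> real" and v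
  have P_if: "P H v = (\<Sum>\<sigma>\<in>?S. if \<sigma> k = v then H \<sigma> else 0)" for H v
    unfolding P_def using fin by (subst sum.inter_filter[symmetric]) auto
  have "(\<Sum>v\<in>V. P F v) = (\<Sum>\<sigma>\<in>?S. F \<sigma>)"
    unfolding P_if using V k by (subst sum.swap) (intro sum.cong refl, auto simp: permutes_in_image)
  then have "(\<Sum>v\<in>V. P F v) = 0" using F by (simp add: eigenfunction_def)
  moreover have "(\<Sum>j\<in>V. rw_lap V \<alpha> v j * P F j) = l * P F v" if v: "v \<in> V" for v
  proof -
    have tr: "P (\<lambda>\<sigma>. F (transpose i j \<circ> \<sigma>)) v = P F (transpose i j v)" if "i \<in> V" "j \<in> V" for i j
    proof -
      have "P F (transpose i j v) = (\<Sum>\<sigma>\<in>?S. if (transpose i j \<circ> \<sigma>) k = transpose i j v then F (transpose i j \<circ> \<sigma>) else 0)"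
        unfolding P_if by (rule setum_permutations_compose_left) (simp add: permutes_swap_id that)
      moreover have "(transpose i j \<circ> \<sigma>) k = transpose i j v \<longleftrightarrow> \<sigma> k = v" for \<sigma>
        by (metis comp_apply transpose_involutory)
      ultimately show ?thesis by (simp only: P_if)
    qed
    have "l * P F v = P (\<lambda>\<sigma>. l * F \<sigma>) v" by (simp add: P_def sum_distrib_left)
    also have "\<dots> = P (\<lambda>\<sigma>. (\<Sum>i\<in>V. \<Sum>j\<in>V. \<alpha> i j * (F \<sigma> - F (transpose i j \<circ> \<sigma>))) / 2) v"
      unfolding P_def using F
      by (intro sum.cong refl) (auto simp: eigenfunction_def ip_lap_apply[OF V, symmetric])
    also have "\<dots> = (\<Sum>i\<in>V. \<Sum>j\<in>V. P (\<lambda>\<sigma>. \<alpha> i j * (F \<sigma> - F (transpose i j \<circ> \<sigma>))) v) / 2"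
      unfolding P_def sum_divide_distrib[symmetric] by (subst sum_swap3) (rule refl)
    also have "\<dots> = (\<Sum>i\<in>V. \<Sum>j\<in>V. \<alpha> i j * (P F v - P F (transpose i j v))) / 2"
    proof -
      have "P (\<lambda>\<sigma>. \<alpha> i j * (F \<sigma> - F (transpose i j \<circ> \<sigma>))) v = \<alpha> i j * (P F v - P F (transpose i j v))"
        if "i \<in> V" "j \<in> V" for i j
        unfolding tr[OF that, symmetric] by (simp add: P_def sum_distrib_left sum_subtractf right_diff_distrib)
      then show ?thesis by simp
    qed
    also have "\<dots> = (\<Sum>j\<in>V. rw_lap V \<alpha> v j * P F j)"
      by (simp add: sum_transpose_diff[OF V v] rw_lap_apply[OF V v])
    finally show ?thesis by simp
  qed
  ultimately show ?thesis using nz unfolding eigenfunction_def P_def by blast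
qed

section \<open>Removing a vertex\<close>

text \<open>Legs of weight 0 drop out, which leaves the octopus inequality for the elements of
  \<open>T\<close>. The factor 2 comes from summing over ordered pairs.\<close>

lemma octopus_support_card_le_3:
  fixes F :: "('a \<Rightarrow> 'a) \<Rightarrow> real"
  assumes V: "finite V" "x \<in> V" and T: "T \<subseteq> V - {x}" "card T \<le> 3"
    and a: "\<And>y. y \<in> V - {x} \<Longrightarrow> 0 \<le> a y" "\<And>y. y \<in> V - {x} - T \<Longrightarrow> a y = 0"
  shows "(\<Sum>\<sigma> | \<sigma> permutes V. \<Sum>y\<in>V - {x}. \<Sum>z\<in>V - {x}. a y * a z * (F \<sigma> - F (transpose y z \<circ> \<sigma>))\<^sup>2) \<le>
    2 * (\<Sum>y\<in>V - {x}. a y) * (\<Sum>\<sigma> | \<sigma> permutes V. \<Sum>y\<in>V - {x}. a y * (F \<sigma> - F (transpose x y \<circ> \<sigma>))\<^sup>2)"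
proof -
  let ?S = "{\<sigma>. \<sigma> permutes V}"
  have finT: "finite T" using T V by (meson finite_Diff finite_subset)
  have pos: "0 \<le> a y" if "y \<in> T" for y using a T that by blast
  have supp: "(\<Sum>y\<in>V - {x}. a y * h y) = (\<Sum>y\<in>T. a y * h y)" for h
    using V T a(2) by (intro sum.mono_neutral_right) auto
  have supp1: "(\<Sum>y\<in>V - {x}. a y) = (\<Sum>y\<in>T. a y)" using supp[of "\<lambda>_. 1"] by simp
  have "(\<Sum>y\<in>V - {x}. \<Sum>z\<in>V - {x}. a y * a z * h y z) = (\<Sum>y\<in>T. \<Sum>z\<in>T. a y * a z * h y z)" for h
    unfolding mult.assoc sum_distrib_left[symmetric] supp ..
  moreover have "(\<Sum>\<sigma>\<in>?S. \<Sum>y\<in>T. \<Sum>z\<in>T. a y * a z * (F \<sigma> - F (transpose y z \<circ> \<sigma>))\<^sup>2) \<le>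
      2 * ((\<Sum>y\<in>T. a y) * (\<Sum>\<sigma>\<in>?S. \<Sum>y\<in>T. a y * (F \<sigma> - F (transpose x y \<circ> \<sigma>))\<^sup>2))"
  proof -
    have "card T = 0 \<or> card T = 1 \<or> card T = 2 \<or> card T = 3" using T by linarith
    then consider "T = {}" | p where "T = {p}" | p q where "T = {p, q}" "p \<noteq> q"
      | p q r where "T = {p, q, r}" "p \<noteq> q" "p \<noteq> r" "q \<noteq> r"
      using finT by (auto simp: card_2_iff card_3_iff card_1_singleton_iff)
    then show ?thesis
    proof cases
      case 1
      then show ?thesis by simp
    next
      \<comment> \<open>With one leg the left side contains only the trivial transposition and is
        0.\<close>
      case 2
      then show ?thesis using pos by (auto intro!: mult_nonneg_nonneg sum_nonneg)
    next
      case 3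
      have dbl: "(\<Sum>y\<in>T. \<Sum>z\<in>T. a y * a z * (F \<sigma> - F (transpose y z \<circ> \<sigma>))\<^sup>2) =
          2 * (a p * a q * (F \<sigma> - F (transpose p q \<circ> \<sigma>))\<^sup>2)" for \<sigma>
        using 3 by (simp add: transpose_commute[of q p] del: o_apply)
      have sgl: "(\<Sum>y\<in>T. a y * h y) = a p * h p + a q * h q" for h
        using 3 by simp
      have "(\<Sum>\<sigma>\<in>?S. a p * a q * (F \<sigma> - F (transpose p q \<circ> \<sigma>))\<^sup>2) \<le>
          (a p + a q) * (\<Sum>\<sigma>\<in>?S. a p * (F \<sigma> - F (transpose x p \<circ> \<sigma>))\<^sup>2 + a q * (F \<sigma> - F (transpose x q \<circ> \<sigma>))\<^sup>2)"
        by (rule octopus_2) (use 3 V T pos in auto)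
      also have "a p + a q = (\<Sum>y\<in>T. a y)" using 3 by simp
      finally show ?thesis
        unfolding dbl sgl sum_distrib_left[of 2, symmetric] by (rule mult_left_mono) simp
    next
      case 4
      have dbl: "(\<Sum>y\<in>T. \<Sum>z\<in>T. a y * a z * (F \<sigma> - F (transpose y z \<circ> \<sigma>))\<^sup>2) =
          2 * (a p * a q * (F \<sigma> - F (transpose p q \<circ> \<sigma>))\<^sup>2 + a p * a r * (F \<sigma> - F (transpose p r \<circ> \<sigma>))\<^sup>2
            + a q * a r * (F \<sigma> - F (transpose q r \<circ> \<sigma>))\<^sup>2)" for \<sigma>
        using 4 by (simp add: transpose_commute[of q p] transpose_commute[of r p] transpose_commute[of r q]
            del: o_apply)
      have sgl: "(\<Sum>y\<in>T. a y * h y) = a p * h p + a q * h q + a r * h r" for h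
        using 4 by simp
      have "(\<Sum>\<sigma>\<in>?S. a p * a q * (F \<sigma> - F (transpose p q \<circ> \<sigma>))\<^sup>2 + a p * a r * (F \<sigma> - F (transpose p r \<circ> \<sigma>))\<^sup>2
            + a q * a r * (F \<sigma> - F (transpose q r \<circ> \<sigma>))\<^sup>2) \<le>
          (a p + a q + a r) * (\<Sum>\<sigma>\<in>?S. a p * (F \<sigma> - F (transpose x p \<circ> \<sigma>))\<^sup>2
            + a q * (F \<sigma> - F (transpose x q \<circ> \<sigma>))\<^sup>2 + a r * (F \<sigma> - F (transpose x r \<circ> \<sigma>))\<^sup>2)"
        by (rule octopus_3) (use 4 V T pos in auto)
      also have "a p + a q + a r = (\<Sum>y\<in>T. a y)" using 4 by simp
      finally show ?thesis
        unfolding dbl sgl sum_distrib_left[of 2, symmetric] by (rule mult_left_mono) simp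
    qed
  qed
  ultimately show ?thesis unfolding supp supp1 by (simp only: mult.assoc)
qed

text \<open>Removing \<open>x\<close> loses the energy \<open>2 * B\<close> of its edges and gains
  \<open>A / s\<close> from the new weights; the octopus inequality compares the two.\<close>

lemma ip_form_reduced_le:
  assumes V: "finite V" "weights_on V \<alpha>" "x \<in> V" and T: "T \<subseteq> V - {x}" "card T \<le> 3"
    and supp: "\<And>y. y \<in> V - {x} - T \<Longrightarrow> \<alpha> x y = 0"
  shows "ip_form V (V - {x}) (reduced_weights V x \<alpha>) F \<le> ip_form V V \<alpha> F"
proof -
  let ?S = "{\<sigma>. \<sigma> permutes V}" and ?W = "V - {x}"
  define D where "D \<sigma> i j = (F \<sigma> - F (transpose i j \<circ> \<sigma>))\<^sup>2" for \<sigma> i j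
  define s where "s = (\<Sum>y\<in>?W. \<alpha> x y)"
  define A where "A = (\<Sum>\<sigma>\<in>?S. \<Sum>y\<in>?W. \<Sum>z\<in>?W. \<alpha> x y * \<alpha> x z * D \<sigma> y z)"
  define B where "B = (\<Sum>\<sigma>\<in>?S. \<Sum>y\<in>?W. \<alpha> x y * D \<sigma> x y)"
  have sym: "\<alpha> y x = \<alpha> x y" and pos: "0 \<le> \<alpha> x y" if "y \<in> ?W" for y
    using weights_onD[OF V(2)] V(3) that by auto
  have D_sym: "D \<sigma> i j = D \<sigma> j i" and D_diag: "D \<sigma> i i = 0" for \<sigma> i j
    by (simp_all add: D_def transpose_commute)
  have "(\<Sum>i\<in>V. \<Sum>j\<in>V. \<alpha> i j * D \<sigma> i j) =
      (\<Sum>i\<in>?W. \<Sum>j\<in>?W. \<alpha> i j * D \<sigma> i j) + 2 * (\<Sum>y\<in>?W. \<alpha> x y * D \<sigma> x y)" for \<sigma>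
  proof -
    have "(\<Sum>i\<in>V. \<Sum>j\<in>V. \<alpha> i j * D \<sigma> i j) = (\<Sum>i\<in>V. \<alpha> i x * D \<sigma> i x + (\<Sum>j\<in>?W. \<alpha> i j * D \<sigma> i j))"
      using V by (simp add: sum.remove[of V x])
    also have "\<dots> = (\<Sum>j\<in>?W. \<alpha> x j * D \<sigma> x j) + ((\<Sum>i\<in>?W. \<alpha> i x * D \<sigma> i x) + (\<Sum>i\<in>?W. \<Sum>j\<in>?W. \<alpha> i j * D \<sigma> i j))"
      using V by (subst sum.remove[of V x]) (simp_all add: D_diag sum.distrib)
    also have "(\<Sum>i\<in>?W. \<alpha> i x * D \<sigma> i x) = (\<Sum>j\<in>?W. \<alpha> x j * D \<sigma> x j)"
      by (intro sum.cong refl) (simp add: sym D_sym)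
    finally show ?thesis by simp
  qed
  then have full: "ip_form V V \<alpha> F = ip_form V ?W \<alpha> F + 2 * B"
    by (simp add: ip_form_def D_def[symmetric] B_def sum.distrib sum_distrib_left del: o_apply)
  have "ip_form V ?W (reduced_weights V x \<alpha>) F =
      (\<Sum>\<sigma>\<in>?S. \<Sum>i\<in>?W. \<Sum>j\<in>?W. \<alpha> i j * D \<sigma> i j + \<alpha> x i * \<alpha> x j * D \<sigma> i j / s)"
    unfolding ip_form_def D_def[symmetric]
    by (intro sum.cong refl) (simp add: reduced_weights_def s_def[symmetric] sym distrib_right)
  also have "\<dots> = ip_form V ?W \<alpha> F + A / s"
    by (simp add: sum.distrib ip_form_def D_def[symmetric] A_def sum_divide_distrib del: o_apply)
  finally have red: "ip_form V ?W (reduced_weights V x \<alpha>) F = ip_form V ?W \<alpha> F + A / s" .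
  have "A \<le> 2 * s * B"
    unfolding A_def s_def B_def D_def
    by (rule octopus_support_card_le_3[OF V(1,3) T]) (use pos supp in auto)
  moreover have "0 \<le> s" unfolding s_def using pos by (intro sum_nonneg)
  moreover have "0 \<le> B" unfolding B_def D_def using pos by (intro sum_nonneg mult_nonneg_nonneg) auto
  \<comment> \<open>For \<open>s = 0\<close> the quotient is 0 and the claim is the nonnegativity of
    \<open>B\<close>.\<close>
  ultimately have "A / s \<le> 2 * B" by (cases "s = 0") (auto simp: divide_le_eq mult_ac)
  then show ?thesis unfolding full red by simp
qed

text \<open>Only the lower bound for the interchange process; \<open>eigenfunction_lift\<close>
  gives the other direction. In terms of \<open>poincare\<close> it also makes sense for one vertex,
  where there is no second eigenvalue and the induction starts.\<close>

definition aldous :: "nat set \<Rightarrow> (nat \<Rightarrow> nat \<Rightarrow> real) \<Rightarrow> bool" where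
  "aldous V \<alpha> \<longleftrightarrow> (\<forall>l\<ge>0. poincare V (rw_lap V \<alpha>) l \<longrightarrow> poincare {\<sigma>. \<sigma> permutes V} (ip_lap V \<alpha>) l)"

lemma card_permutes_ge_2:
  assumes "finite V" "card V \<ge> 2"
  shows "card {\<sigma>. \<sigma> permutes V} \<ge> 2"
  using card_permutations[OF refl assms(1)] fact_ge_self[of "card V"] assms(2) by linarith

lemma aldous_step:
  assumes V: "finite V" "weights_on V \<alpha>" "x \<in> V" "card V \<ge> 2"
    and T: "T \<subseteq> V - {x}" "card T \<le> 3" "\<And>y. y \<in> V - {x} - T \<Longrightarrow> \<alpha> x y = 0"
    and IH: "aldous (V - {x}) (reduced_weights V x \<alpha>)"
  shows "aldous V \<alpha>"
  unfolding aldous_def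
proof (intro allI impI)
  fix l :: real
  assume l: "0 \<le> l" "poincare V (rw_lap V \<alpha>) l"
  let ?S = "{\<sigma>. \<sigma> permutes V}" and ?W = "V - {x}" and ?\<beta> = "reduced_weights V x \<alpha>"
  have fin: "finite ?S" using V by (simp add: finite_permutations)
  obtain \<mu> F where F: "eigenfunction ?S (ip_lap V \<alpha>) \<mu> F" and \<mu>: "poincare ?S (ip_lap V \<alpha>) \<mu>"
    using ex_spectral_gap[OF fin card_permutes_ge_2[OF V(1,4)] symmetric_zero_sums_ip_lap[OF V(1,2)]] by blast
  have "l \<le> \<mu>"
  \<comment> \<open>A nonzero marginal of one particle is a random walk eigenfunction for \<mu>,
    which gives the bound at once. Otherwise all marginals of \<open>F\<close> vanish.\<close>
  proof (cases "\<exists>k\<in>V. \<exists>v\<in>V. (\<Sum>\<sigma> | \<sigma> permutes V \<and> \<sigma> k = v. F \<sigma>) \<noteq> 0")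
    case True
    then show ?thesis
      using eigenfunction_project[OF V(1,2) F] poincare_le_eigenvalue[OF V(1) l(2)] by blast
  next
    case False
    have W: "finite ?W" "weights_on ?W ?\<beta>" using V weights_on_reduced[OF V(2,3)] by auto
    have "poincare {\<tau>. \<tau> permutes ?W} (ip_lap ?W ?\<beta>) l"
      using IH l poincare_reduced[OF V(1-3)] by (simp add: aldous_def)
    then have cosets: "l * (\<Sum>\<tau> | \<tau> permutes ?W. (G \<tau>)\<^sup>2) \<le> ip_form ?W ?W ?\<beta> G / 4"
      if "(\<Sum>\<tau> | \<tau> permutes ?W. G \<tau>) = 0" for G
      using that unfolding poincare_def bilin_ip_lap[OF W] by blast
    \<comment> \<open>The permutations sending \<open>k\<close> to \<open>x\<close> are exactly the
      \<open>\<tau> \<circ> transpose x k\<close> with \<tau> fixing \<open>x\<close>, so this is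
      the vanishing marginal at \<open>v = x\<close>.\<close>
    have zero: "(\<Sum>\<tau> | \<tau> permutes ?W. F (\<tau> \<circ> transpose x k)) = 0" if k: "k \<in> V" for k
    proof -
      have "0 = (\<Sum>\<sigma> | \<sigma> permutes V \<and> \<sigma> k = x. F \<sigma>)" using False V k by auto
      also have "\<dots> = (\<Sum>\<sigma>\<in>?S. if \<sigma> k = x then F \<sigma> else 0)"
        using fin by (subst sum.inter_filter[symmetric]) auto
      also have "\<dots> = (\<Sum>b\<in>V. \<Sum>\<tau> | \<tau> permutes ?W. if (\<tau> \<circ> transpose x b) k = x then F (\<tau> \<circ> transpose x b) else 0)"
        by (rule sum_permutes_split[OF V(1,3)])
      also have "\<dots> = (\<Sum>b\<in>V. if b = k then \<Sum>\<tau> | \<tau> permutes ?W. F (\<tau> \<circ> transpose x b) else 0)"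
      proof (intro sum.cong refl)
        fix b assume "b \<in> V"
        have "(\<tau> \<circ> transpose x b) k = x \<longleftrightarrow> b = k" if "\<tau> permutes ?W" for \<tau>
        proof -
          have "\<tau> x = x" using that by (simp add: permutes_not_in)
          then have "\<tau> y = x \<longleftrightarrow> y = x" for y using permutes_inj[OF that] by (metis injD)
          then show ?thesis by (auto simp: transpose_def)
        qed
        then show "(\<Sum>\<tau> | \<tau> permutes ?W. if (\<tau> \<circ> transpose x b) k = x then F (\<tau> \<circ> transpose x b) else 0) =
            (if b = k then \<Sum>\<tau> | \<tau> permutes ?W. F (\<tau> \<circ> transpose x b) else 0)"
          by (auto intro!: sum.cong sum.neutral simp del: o_apply)
      qed
      also have "\<dots> = (\<Sum>\<tau> | \<tau> permutes ?W. F (\<tau> \<circ> transpose x k))" using V k by simp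
      finally show ?thesis by simp
    qed
    \<comment> \<open>The induction hypothesis applies on each coset. Transpositions within
      \<open>?W\<close> act on the left and preserve the cosets, so the coset energies add up to the
      energy of \<open>F\<close> for the reduced weights.\<close>
    have "l * (\<Sum>\<sigma>\<in>?S. (F \<sigma>)\<^sup>2) = (\<Sum>k\<in>V. l * (\<Sum>\<tau> | \<tau> permutes ?W. (F (\<tau> \<circ> transpose x k))\<^sup>2))"
      by (subst sum_permutes_split[OF V(1,3)]) (simp add: sum_distrib_left)
    also have "\<dots> \<le> (\<Sum>k\<in>V. ip_form ?W ?W ?\<beta> (\<lambda>\<tau>. F (\<tau> \<circ> transpose x k)) / 4)"
      by (intro sum_mono cosets zero)
    also have "\<dots> = ip_form V ?W ?\<beta> F / 4"
      unfolding ip_form_def by (subst sum_permutes_split[OF V(1,3)]) (simp add: sum_divide_distrib comp_assoc)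
    also have "\<dots> \<le> ip_form V V \<alpha> F / 4" using ip_form_reduced_le[OF V(1-3) T] by simp
    also have "\<dots> = \<mu> * (\<Sum>\<sigma>\<in>?S. (F \<sigma>)\<^sup>2)"
      using bilin_eigenfunction[OF F] by (simp add: bilin_ip_lap[OF V(1,2)])
    finally show ?thesis using sum_squares_eigenfunction_pos[OF fin F] by simp
  qed
  then show "poincare ?S (ip_lap V \<alpha>) l"
    using \<mu> unfolding poincare_def by (meson mult_right_mono order_trans sum_nonneg zero_le_power2)
qed

text \<open>The hub keeps its label \<open>n\<close> while the rim shrinks to
  \<open>1, ..., m\<close>, so \<open>m\<close> may be smaller than \<open>n - 1\<close>. The spokes
  are unrestricted.\<close>

definition wheel_weights :: "nat \<Rightarrow> nat \<Rightarrow> (nat \<Rightarrow> nat \<Rightarrow> real) \<Rightarrow> bool" where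
  "wheel_weights m n \<alpha> \<longleftrightarrow> weights_on ({1..m} \<union> {n}) \<alpha> \<and>
     (\<forall>i\<in>{1..m}. \<forall>j\<in>{1..m}. i \<noteq> j \<and> i \<noteq> Suc j \<and> j \<noteq> Suc i \<and> {i, j} \<noteq> {1, m} \<longrightarrow> \<alpha> i j = 0)"

text \<open>The removed vertex has only \<open>1\<close> and \<open>m\<close> as possible rim
  neighbours. These become adjacent on the shorter cycle, so a new weight between rim vertices is
  allowed; all others concern spokes or the diagonal.\<close>

lemma wheel_weights_reduced:
  assumes "wheel_weights (Suc m) n \<alpha>" "Suc m < n"
  shows "wheel_weights m n (reduced_weights ({1..Suc m} \<union> {n}) (Suc m) \<alpha>)"
proof -
  let ?V = "{1..Suc m} \<union> {n}"
  have V: "?V - {Suc m} = {1..m} \<union> {n}" using assms(2) by auto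
  have w: "weights_on ?V \<alpha>" using assms by (simp add: wheel_weights_def)
  have far: "\<alpha> i j = 0" if "i \<in> {1..Suc m}" "j \<in> {1..Suc m}" "i \<noteq> j" "i \<noteq> Suc j" "j \<noteq> Suc i" "{i, j} \<noteq> {1, Suc m}" for i j
    using assms that by (auto simp: wheel_weights_def)
  have "reduced_weights ?V (Suc m) \<alpha> i j = 0"
    if ij: "i \<in> {1..m}" "j \<in> {1..m}" "i \<noteq> j" "i \<noteq> Suc j" "j \<noteq> Suc i" "{i, j} \<noteq> {1, m}" for i j
  proof -
    have "\<alpha> i j = 0" by (rule far) (use ij in \<open>auto simp: doubleton_eq_iff\<close>)
    moreover have "\<alpha> i (Suc m) = 0 \<or> \<alpha> (Suc m) j = 0"
    proof (cases "i \<in> {1, m}")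
      case True
      then have "j \<notin> {1, m}" using ij by auto
      then have "\<alpha> (Suc m) j = 0" by (intro far) (use ij in \<open>auto simp: doubleton_eq_iff\<close>)
      then show ?thesis ..
    next
      case False
      then have "\<alpha> i (Suc m) = 0" by (intro far) (use ij in \<open>auto simp: doubleton_eq_iff\<close>)
      then show ?thesis ..
    qed
    ultimately show ?thesis by (auto simp: reduced_weights_def)
  qed
  then show ?thesis
    using weights_on_reduced[OF w, of "Suc m"] unfolding wheel_weights_def V by auto
qed

lemma aldous_wheel:
  assumes "wheel_weights m n \<alpha>" "m < n"
  shows "aldous ({1..m} \<union> {n}) \<alpha>"
  using assms
proof (induction m arbitrary: \<alpha>)
  case 0
  \<comment> \<open>The identity is the only permutation, so a function of sum zero
    vanishes.\<close>
  have "{\<sigma>. \<sigma> permutes {n}} = {id}" by (auto simp: permutes_sing)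
  then show ?case by (auto simp: aldous_def poincare_def bilin_def)
next
  case (Suc m)
  \<comment> \<open>\<open>?T\<close> holds the rim neighbours of \<open>Suc m\<close> and the hub.
    The intersection matters for \<open>m = 0\<close>, where only the hub remains.\<close>
  let ?V = "{1..Suc m} \<union> {n}" and ?T = "{1, m, n} \<inter> ({1..m} \<union> {n})"
  have V: "?V - {Suc m} = {1..m} \<union> {n}" using Suc.prems by auto
  have w: "weights_on ?V \<alpha>" using Suc.prems by (simp add: wheel_weights_def)
  show ?case
  proof (rule aldous_step[OF _ w, where x = "Suc m" and T = ?T])
    have "card {Suc m, n} \<le> card ?V" by (rule card_mono) auto
    then show "card ?V \<ge> 2" using Suc.prems by simp
    have "card ?T \<le> card {1, m, n}" by (rule card_mono) auto
    also have "\<dots> \<le> 3" by (simp add: card_insert_if)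
    finally show "card ?T \<le> 3" .
    show "\<alpha> (Suc m) y = 0" if "y \<in> ?V - {Suc m} - ?T" for y
    proof -
      have "y \<in> {1..m}" "y \<noteq> 1" "y \<noteq> m" using that by auto
      then show ?thesis
        using Suc.prems(1) unfolding wheel_weights_def by (auto simp: doubleton_eq_iff)
    qed
    show "aldous (?V - {Suc m}) (reduced_weights ?V (Suc m) \<alpha>)"
      unfolding V using Suc.prems by (intro Suc.IH wheel_weights_reduced) auto
  qed (use V in auto)
qed

section \<open>The wheel graph and its two spectral gaps\<close>

lemma wheel_weights_wheel_graph:
  assumes n: "n \<ge> 4" and ew: "edge_weights (wheel_graph n) \<alpha>"
  shows "wheel_weights (n - 1) n \<alpha>"
proof -
  have V: "{1..n - 1} \<union> {n} = {1..n}" using n by auto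
  have "\<alpha> i j = 0"
    if ij: "i \<in> {1..n - 1}" "j \<in> {1..n - 1}" "i \<noteq> j" "i \<noteq> Suc j" "j \<noteq> Suc i" "{i, j} \<noteq> {1, n - 1}" for i j
  proof -
    \<comment> \<open>The rim is numbered from 1, so the modulus wraps \<open>n - 1\<close> around
      to 1.\<close>
    have next_rim: "k mod (n - 1) + 1 = (if k = n - 1 then 1 else Suc k)" if "k < n" for k
      using n that by (cases "k = n - 1") auto
    have "(i, j) \<notin> parcs (wheel_graph n)"
    proof
      assume "(i, j) \<in> parcs (wheel_graph n)"
      then obtain k where k: "k \<in> {1..<n}"
        and e: "(i, j) \<in> {(k, n), (n, k), (k, k mod (n - 1) + 1), (k mod (n - 1) + 1, k)}"
        unfolding wheel_graph_def pair_pre_digraph.simps by blast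
      have "i \<noteq> n" "j \<noteq> n" using ij n by auto
      with e have "{i, j} = {k, k mod (n - 1) + 1}" by auto
      then have "{i, j} = {k, if k = n - 1 then 1 else Suc k}" using k next_rim[of k] by simp
      then show False using ij by (auto simp: doubleton_eq_iff split: if_splits)
    qed
    moreover have "i \<in> pverts (wheel_graph n)" "j \<in> pverts (wheel_graph n)"
      using ij by (auto simp: wheel_graph_def)
    ultimately show ?thesis using ew unfolding edge_weights_def by blast
  qed
  moreover have "weights_on {1..n} \<alpha>"
    using ew by (auto simp: edge_weights_def wheel_graph_def weights_on_def)
  ultimately show ?thesis unfolding wheel_weights_def V by blast
qed

theorem mainTheorem6:
  fixes n :: nat and \<alpha> :: "nat \<Rightarrow> nat \<Rightarrow> real"
  assumes "n \<ge> 4"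
    and "edge_weights (wheel_graph n) \<alpha>"
    and "connected (with_proj (remove_zero_edges \<alpha> (wheel_graph n)))"
  shows "interchange_spectral_gap n \<alpha> = rw_spectral_gap n \<alpha>"
proof -
  let ?V = "{1..n}"
  let ?S = "{\<sigma>. \<sigma> permutes ?V}"
  have V': "{1..n - 1} \<union> {n} = ?V" using assms(1) by auto
  have ww: "wheel_weights (n - 1) n \<alpha>" by (rule wheel_weights_wheel_graph) fact+
  have V: "finite ?V" "weights_on ?V \<alpha>" using ww V' by (auto simp: wheel_weights_def)
  have card: "card ?V \<ge> 2" using assms(1) by simp
  have fin: "finite ?S" by (simp add: finite_permutations)
  have rw: "rw_laplacian n \<alpha> = rw_lap ?V \<alpha>"
    by (simp add: fun_eq_iff rw_laplacian_def rw_lap_def)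
  have pairs: "(i, j) \<in> vertex_pairs n \<longleftrightarrow> i \<in> ?V \<and> j \<in> ?V \<and> i < j" for i j
    by (auto simp: vertex_pairs_def)
  have vp: "vertex_pairs n = {(i, j). i \<in> ?V \<and> j \<in> ?V \<and> i < j}"
    by (auto simp: vertex_pairs_def)
  have ip: "interchange_laplacian n \<alpha> = ip_lap ?V \<alpha>"
    unfolding interchange_laplacian_def[abs_def] ip_lap_def[abs_def] pairs unfolding vp ..
  obtain l f where f: "eigenfunction ?V (rw_lap ?V \<alpha>) l f" and l: "poincare ?V (rw_lap ?V \<alpha>) l"
    using ex_spectral_gap[OF V(1) card symmetric_zero_sums_rw_lap[OF V]] by blast
  \<comment> \<open>Nonnegative energy is the \<open>poincare\<close> bound with constant 0, and
    comparing it with the eigenfunction \<open>f\<close> gives \<open>0 \<le> l\<close>.\<close>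
  have "0 \<le> rw_form ?V \<alpha> g" for g
    unfolding rw_form_def by (intro sum_nonneg mult_nonneg_nonneg weights_onD(2)[OF V(2)]) auto
  then have "poincare ?V (rw_lap ?V \<alpha>) 0"
    unfolding poincare_def bilin_rw_lap[OF V] by (simp del: One_nat_def)
  then have l0: "0 \<le> l" using poincare_le_eigenvalue[OF V(1) _ f] by blast
  have "aldous ?V \<alpha>" using aldous_wheel[OF ww] assms(1) V' by simp
  then have "poincare ?S (ip_lap ?V \<alpha>) l" using l l0 by (simp add: aldous_def)
  \<comment> \<open>Following particle 1 shows that the lower bound \<open>l\<close> is attained by
    the interchange process.\<close>
  moreover have "eigenfunction ?S (ip_lap ?V \<alpha>) l (\<lambda>\<sigma>. f (\<sigma> 1))"
    using assms(1) by (intro eigenfunction_lift[OF V _ f]) auto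
  ultimately have "interchange_spectral_gap n \<alpha> = l"
    unfolding interchange_spectral_gap_def ip
    using second_smallest_eigenvalue_eq[OF fin card_permutes_ge_2[OF V(1) card] symmetric_zero_sums_ip_lap[OF V]] l0
    by blast
  moreover have "rw_spectral_gap n \<alpha> = l"
    unfolding rw_spectral_gap_def rw
    by (rule second_smallest_eigenvalue_eq[OF V(1) card symmetric_zero_sums_rw_lap[OF V] f l l0])
  ultimately show ?thesis by simp
qed

end
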